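(* Let $F$ be a fixed graph and $\alpha\in(0,1)$. For every $\delta>0$ there exist constants $K_1,K_2>0$ such that, if $K_1n^{2-1/d^*(F)}\leq t\leq n^{2-\delta}$, then there exists a successful $\big(t,\,K_2t^{1-d^*(F)}n^{2d^*(F)-1}\big)$-strategy for an $\alpha$-$F$-factor.
   Context: Budget-constrained random graph process: let $M=\binom{n}{2}$. The edges of $K_n$ on vertex set $[n]$ are put in a uniformly random order $e_1,e_2,\ldots,e_M$. Builder is presented $e_1,\ldots,e_t$ one by one and, as each edge is presented and without knowledge of future edges, must irrevocably decide (possibly using additional randomness) whether to purchase it; she may purchase at most $b$ edges in total. A $(t,b)$-strategy is a rule for these decisions; $B_t$ denotes the graph of purchased edges after time $t$. A strategy is successful for a property if $B_t$ satisfies it with probability tending to $1$ as $n\to\infty$. A graph on $n$ vertices contains an $\alpha$-$F$-factor if it contains at least $\alpha n/v(F)$ vertex-disjoint copies of $F$. For $F$ with at least two vertices, $d(F)=e(F)/(v(F)-1)$ and $d^*(F)=\max\{d(F'):F'\subseteq F,\ v(F')\geq2\}$; all graphs $F$ are assumed to have at least one edge. *)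

theory Defs
  imports
    "HOL-Library.Ramsey"
    "HOL-Library.Disjoint_Sets"
    "HOL-Combinatorics.Multiset_Permutations"
    "HOL-Probability.Probability_Mass_Function"
begin

section \<open>Finite simple graphs\<close>

text \<open>A graph is a pair of a vertex set and a set of edges, the edges being two-element vertex
  sets; \<open>[V]\<^bsup>2\<^esup>\<close> is the set of all two-element subsets of \<open>V\<close>.\<close>

type_synonym 'a graph = "'a set \<times> 'a set set"

abbreviation verts :: "'a graph \<Rightarrow> 'a set" where
  "verts \<equiv> fst"

abbreviation edges :: "'a graph \<Rightarrow> 'a set set" where
  "edges \<equiv> snd"

definition simple_graph :: "'a graph \<Rightarrow> bool" where
  "simple_graph G \<longleftrightarrow> finite (verts G) \<and> edges G \<subseteq> [verts G]\<^bsup>2\<^esup>"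

definition subgraph :: "'a graph \<Rightarrow> 'a graph \<Rightarrow> bool" where
  "subgraph H G \<longleftrightarrow> simple_graph H \<and> verts H \<subseteq> verts G \<and> edges H \<subseteq> edges G"

definition graph_iso :: "'a graph \<Rightarrow> 'b graph \<Rightarrow> bool" where
  "graph_iso G H \<longleftrightarrow>
     (\<exists>f. bij_betw f (verts G) (verts H) \<and> edges H = (\<lambda>e. f ` e) ` edges G)"

definition density :: "'a graph \<Rightarrow> real" where
  "density F = real (card (edges F)) / (real (card (verts F)) - 1)"

definition max_density :: "'a graph \<Rightarrow> real" where
  "max_density F = Max (density ` {F'. subgraph F' F \<and> card (verts F') \<ge> 2})"

definition has_factor :: "real \<Rightarrow> 'a graph \<Rightarrow> 'b graph \<Rightarrow> bool" where
  "has_factor \<alpha> F G \<longleftrightarrow>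
     (\<exists>C. finite C \<and> (\<forall>H\<in>C. subgraph H G \<and> graph_iso F H) \<and> disjoint_family_on verts C \<and>
          real (card C) \<ge> \<alpha> * real (card (verts G)) / real (card (verts F)))"

text \<open>The maximum is over a finite set, which is non-empty once \<open>F\<close> has an edge.\<close>

lemma finite_subgraphs:
  assumes "simple_graph F"
  shows "finite {F'. subgraph F' F \<and> card (verts F') \<ge> 2}"
proof (rule finite_subset)
  show "{F'. subgraph F' F \<and> card (verts F') \<ge> 2} \<subseteq> Pow (verts F) \<times> Pow (edges F)"
    by (auto simp: subgraph_def)
  have "finite (verts F)" "finite (edges F)"
    using assms by (auto simp: simple_graph_def intro: finite_subset finite_imp_finite_nsets)
  then show "finite (Pow (verts F) \<times> Pow (edges F))"
    by simp
qed

lemma subgraphs_nonempty: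
  assumes "simple_graph F" "edges F \<noteq> {}"
  shows "{F'. subgraph F' F \<and> card (verts F') \<ge> 2} \<noteq> {}"
proof -
  obtain e where "e \<in> edges F" using assms by auto
  then have "e \<subseteq> verts F" "card e = 2"
    using assms by (auto simp: simple_graph_def nsets_def)
  then have "card (verts F) \<ge> 2"
    using assms by (metis card_mono simple_graph_def)
  then have "F \<in> {F'. subgraph F' F \<and> card (verts F') \<ge> 2}"
    using assms by (simp add: subgraph_def)
  then show ?thesis by blast
qed


section \<open>The budget-constrained random graph process\<close>

definition edge_orders :: "nat \<Rightarrow> nat set list set" where
  "edge_orders n = permutations_of_set ([{1..n}]\<^bsup>2\<^esup>)"

definition random_edge_order :: "nat \<Rightarrow> nat set list pmf" where
  "random_edge_order n = pmf_of_set (edge_orders n)"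

text \<open>A deterministic rule maps the non-empty list \<open>[e\<^sub>1, \<dots>, e\<^sub>i]\<close> of the edges presented so far to
  the decision whether to purchase the last of them. Earlier decisions are determined by the rule
  and the same list, so they need not be passed as arguments. Builder's additional randomness is
  a random choice of the rule, independent of the order of the edges. As only finitely many lists of
  edges are relevant for given \<open>n\<close>, discrete distributions lose no generality.\<close>

type_synonym rule = "nat set list \<Rightarrow> bool"
type_synonym strategy = "rule pmf"

definition purchased :: "rule \<Rightarrow> nat set list \<Rightarrow> nat set set" where
  "purchased r es = {es ! i | i. i < length es \<and> r (take (Suc i) es)}"

definition builder_graph :: "nat \<Rightarrow> nat \<Rightarrow> rule \<Rightarrow> nat set list \<Rightarrow> nat graph" where
  "builder_graph n t r es = ({1..n}, purchased r (take t es))"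

text \<open>The budget \<open>b\<close> is real and need not be an integer. It must be respected surely, not just
  with high probability.\<close>

definition is_strategy :: "nat \<Rightarrow> nat \<Rightarrow> real \<Rightarrow> strategy \<Rightarrow> bool" where
  "is_strategy n t b S \<longleftrightarrow>
     (\<forall>r \<in> set_pmf S. \<forall>es \<in> edge_orders n. real (card (edges (builder_graph n t r es))) \<le> b)"

definition success_prob :: "nat \<Rightarrow> nat \<Rightarrow> strategy \<Rightarrow> (nat graph \<Rightarrow> bool) \<Rightarrow> real" where
  "success_prob n t S P =
     measure_pmf.prob (pair_pmf S (random_edge_order n)) {(r, es). P (builder_graph n t r es)}"

text \<open>Here the time, the budget and the strategy depend on \<open>n\<close>.\<close>

definition successful_strategy ::
    "(nat \<Rightarrow> nat) \<Rightarrow> (nat \<Rightarrow> real) \<Rightarrow> (nat \<Rightarrow> strategy) \<Rightarrow> (nat graph \<Rightarrow> bool) \<Rightarrow> bool" where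
  "successful_strategy t b S P \<longleftrightarrow>
     (\<forall>n. is_strategy n (t n) (b n) (S n)) \<and>
     (\<lambda>n. success_prob n (t n) (S n) P) \<longlonglongrightarrow> 1"

end

theory Submission
  imports Defs
begin

text \<open>Builder cuts \<open>[n]\<close> into blocks of size \<open>m \<approx> C (n\<^sup>2 / t)\<^bsup>d\<^esup>\<close>, where \<open>d\<close> is the maximum density of \<open>F\<close>, and buys
  exactly the presented edges inside blocks. About \<open>t m / n\<close> such edges appear, which is the order of
  the budget; an exponential moment bound shows that the budget is exhausted with probability tending
  to \<open>0\<close>. With edge density \<open>p \<approx> t / n\<^sup>2\<close> we have \<open>m p\<^bsup>d\<^esup> \<ge> C\<close>, so every subgraph of \<open>F\<close> with an edge has at
  least \<open>C m\<close> expected copies per block, up to a constant factor. Janson's inequality then shows that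
  a fixed set of \<open>(1 - \<alpha>) n\<close> vertices spans no purchased copy of \<open>F\<close> with probability at most
  \<open>exp (- 2 n)\<close>. A union bound over the at most \<open>2\<^bsup>n\<^esup>\<close> such sets gives the factor greedily.\<close>

subsection \<open>Binomial random subsets\<close>

text \<open>The size of the blocks balances cost against Janson's exponent. A block contributes an
  exponent of order \<open>m\<close>, and a set of \<open>(1 - \<alpha>) n\<close> vertices has a
  large part in at least order \<open>n / m\<close> blocks, so together they give order
  \<open>n\<close>, just what is needed against \<open>2 ^ n\<close> vertex sets; the constant
  \<open>C\<close> only has to make the rate large enough. The main obstacle is that the first
  \<open>t\<close> edges of a random order are not independent. Janson's inequality is therefore
  proved for independent edges of probability \<open>t / (2 N)\<close>, with \<open>N\<close> the
  number of pairs, and transferred by monotonicity: a missing copy stays missing when edges are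
  removed. Probabilities are kept as finite sums or as counts of orders until the very end. A second
  obstacle is that the budget binds for every order of the edges, so the rule needs a cutoff. The
  greedy argument is applied only to orders for which the cutoff never acts.\<close>

definition bin_expect :: "real \<Rightarrow> 'e set \<Rightarrow> ('e set \<Rightarrow> real) \<Rightarrow> real" where
  "bin_expect p A f = (\<Sum>S\<in>Pow A. p ^ card S * (1 - p) ^ card (A - S) * f S)"

lemma bin_expect_empty [simp]: "bin_expect p {} f = f {}"
  by (simp add: bin_expect_def)

text \<open>Conditioning on whether \<open>a\<close> is chosen. This recursion drives the inductions
  over the ground set.\<close>

lemma bin_expect_insert:
  assumes "finite A" "a \<notin> A"
  shows "bin_expect p (insert a A) f
    = (1 - p) * bin_expect p A f + p * bin_expect p A (\<lambda>S. f (insert a S))"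
proof -
  let ?w = "\<lambda>S. p ^ card S * (1 - p) ^ card (insert a A - S) * f S"
  have fin: "finite S" if "S \<in> Pow A" for S
    using that assms finite_subset by auto
  have "bin_expect p (insert a A) f = sum ?w (Pow A) + sum ?w (insert a ` Pow A)"
    unfolding bin_expect_def Pow_insert using assms by (intro sum.union_disjoint) auto
  also have "sum ?w (Pow A) = (1 - p) * bin_expect p A f"
    unfolding bin_expect_def sum_distrib_left
  proof (rule sum.cong[OF refl])
    fix S assume S: "S \<in> Pow A"
    have "insert a A - S = insert a (A - S)" using S assms by auto
    then have "card (insert a A - S) = Suc (card (A - S))" using assms by simp
    then show "?w S = (1 - p) * (p ^ card S * (1 - p) ^ card (A - S) * f S)" by simp
  qed
  also have "sum ?w (insert a ` Pow A) = (\<Sum>S\<in>Pow A. ?w (insert a S))"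
    using assms by (intro sum.reindex_cong[of "insert a"]) (auto simp: inj_on_def)
  also have "\<dots> = p * bin_expect p A (\<lambda>S. f (insert a S))"
    unfolding bin_expect_def sum_distrib_left
  proof (rule sum.cong[OF refl])
    fix S assume S: "S \<in> Pow A"
    have "insert a A - insert a S = A - S" "a \<notin> S" using S assms by auto
    then show "?w (insert a S) = p * (p ^ card S * (1 - p) ^ card (A - S) * f (insert a S))"
      using fin[OF S] by simp
  qed
  finally show ?thesis .
qed

lemma bin_expect_cong:
  "(\<And>S. S \<subseteq> A \<Longrightarrow> f S = g S) \<Longrightarrow> bin_expect p A f = bin_expect p A g"
  unfolding bin_expect_def by (intro sum.cong) auto

lemma bin_expect_mono:
  "0 \<le> p \<Longrightarrow> p \<le> 1 \<Longrightarrow> (\<And>S. S \<subseteq> A \<Longrightarrow> f S \<le> g S) \<Longrightarrow> bin_expect p A f \<le> bin_expect p A g"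
  unfolding bin_expect_def by (intro sum_mono mult_left_mono) auto

lemma bin_expect_const: "finite A \<Longrightarrow> bin_expect p A (\<lambda>_. c) = c"
  by (induction A rule: finite_induct) (simp_all add: bin_expect_insert algebra_simps)

lemma bin_expect_diff: "bin_expect p A (\<lambda>S. f S - g S) = bin_expect p A f - bin_expect p A g"
  by (simp add: bin_expect_def algebra_simps sum_subtractf)

lemma bin_expect_cmult: "bin_expect p A (\<lambda>S. c * f S) = c * bin_expect p A f"
  by (simp add: bin_expect_def sum_distrib_left algebra_simps)

lemma bin_expect_sum:
  "bin_expect p A (\<lambda>S. \<Sum>x\<in>X. f x S) = (\<Sum>x\<in>X. bin_expect p A (f x))"
  unfolding bin_expect_def sum_distrib_left by (rule sum.swap)

lemma bin_expect_nonneg: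
  "0 \<le> p \<Longrightarrow> p \<le> 1 \<Longrightarrow> (\<And>S. S \<subseteq> A \<Longrightarrow> 0 \<le> f S) \<Longrightarrow> 0 \<le> bin_expect p A f"
  unfolding bin_expect_def by (intro sum_nonneg mult_nonneg_nonneg) auto

text \<open>The event \<open>B \<subseteq> S\<close> has probability \<open>p ^ card B\<close>, and
  given it the rest of \<open>S\<close> is still binomial on \<open>A - B\<close>.\<close>

lemma bin_expect_superset:
  assumes "finite A" "B \<subseteq> A"
  shows "bin_expect p A (\<lambda>S. if B \<subseteq> S then g S else 0)
    = p ^ card B * bin_expect p (A - B) (\<lambda>S. g (S \<union> B))"
  using assms
proof (induction A arbitrary: B g rule: finite_induct)
  case (insert a A)
  show ?case
  proof (cases "a \<in> B")
    case True
    have 1: "bin_expect p A (\<lambda>S. if B \<subseteq> S then g S else 0) = bin_expect p A (\<lambda>_. 0)"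
      using True insert by (intro bin_expect_cong) auto
    have 2: "bin_expect p A (\<lambda>S. if B \<subseteq> insert a S then g (insert a S) else 0)
       = bin_expect p A (\<lambda>S. if B - {a} \<subseteq> S then g (insert a S) else 0)"
      by (intro bin_expect_cong) auto
    have 3: "insert a (S \<union> (B - {a})) = S \<union> B" for S
      using True by auto
    have 4: "A - (B - {a}) = insert a A - B"
      using True insert by auto
    have 5: "card B = Suc (card (B - {a}))"
      using True insert by (metis card.remove finite.insertI finite_subset)
    have "B - {a} \<subseteq> A" using insert by auto
    from insert.IH[OF this, of "\<lambda>S. g (insert a S)"] show ?thesis
      using insert by (simp add: bin_expect_insert 1 2 3 4 5 bin_expect_const)
  next
    case False
    then have B: "B \<subseteq> A" and 1: "insert a A - B = insert a (A - B)"
      using insert by auto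
    have 2: "B \<subseteq> insert a S \<longleftrightarrow> B \<subseteq> S" for S using False by auto
    show ?thesis
      using insert.IH[OF B] insert.IH[OF B, of "\<lambda>S. g (insert a S)"] insert.hyps False
      by (simp add: bin_expect_insert 1 2 algebra_simps)
  qed
qed simp

text \<open>The case of Harris' inequality that Janson's argument uses: forcing \<open>B\<close>
  into the random set can only lower a decreasing function. With \<open>bin_expect_superset\<close>
  it gives negative correlation with the event \<open>B \<subseteq> S\<close>.\<close>

lemma bin_expect_antimono:
  assumes "finite A" "B \<subseteq> A" "antimono g" "0 \<le> p" "p \<le> 1"
  shows "bin_expect p (A - B) (\<lambda>S. g (S \<union> B)) \<le> bin_expect p A g"
  using assms
proof (induction A arbitrary: B g rule: finite_induct)
  case (insert a A)
  have anti: "antimono (\<lambda>S. g (insert a S))"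
    using insert.prems(2) unfolding antimono_def by (meson insert_mono)
  show ?case
  proof (cases "a \<in> B")
    case True
    have 3: "insert a (S \<union> (B - {a})) = S \<union> B" for S
      using True by auto
    have 4: "A - (B - {a}) = insert a A - B"
      using True insert by auto
    have B: "B - {a} \<subseteq> A" using insert by auto
    have le: "bin_expect p A (\<lambda>S. g (insert a S)) \<le> bin_expect p A g"
      using insert.prems(3,4) antimonoD[OF insert.prems(2)]
      by (intro bin_expect_mono) (simp_all add: subset_insertI)
    have "bin_expect p (insert a A - B) (\<lambda>S. g (S \<union> B)) \<le> bin_expect p A (\<lambda>S. g (insert a S))"
      using insert.IH[OF B anti] insert.prems by (simp add: 3 4)
    also have "\<dots> \<le> bin_expect p (insert a A) g"
      using mult_left_mono[OF le, of "1 - p"] insert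
      by (simp add: bin_expect_insert algebra_simps)
    finally show ?thesis .
  next
    case False
    then have B: "B \<subseteq> A" and 1: "insert a A - B = insert a (A - B)"
      using insert by auto
    show ?thesis
      using insert.IH[OF B, of g] insert.IH[OF B anti] insert.prems insert.hyps False
      by (simp add: bin_expect_insert 1 add_mono mult_left_mono)
  qed
qed simp

text \<open>The hypothesis on \<open>g\<close> says that it ignores the elements of
  \<open>B\<close>. In Janson's argument \<open>B\<close> is one set \<open>E i\<close> and
  \<open>g\<close> concerns only sets disjoint from it.\<close>

lemma bin_expect_indep:
  assumes "finite A" "B \<subseteq> A" "\<And>S T. S - B = T - B \<Longrightarrow> g S = g T"
  shows "bin_expect p (A - B) (\<lambda>S. g (S \<union> B)) = bin_expect p A g"
  using assms
proof (induction A arbitrary: B g rule: finite_induct)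
  case (insert a A)
  show ?case
  proof (cases "a \<in> B")
    case True
    have eq: "g (insert a S) = g S" for S using True by (intro insert.prems(2)) auto
    have eq2: "g (S \<union> B) = g (S \<union> (B - {a}))" for S
      by (intro insert.prems(2)) auto
    have 4: "A - (B - {a}) = insert a A - B"
      using True insert.hyps by auto
    have B: "B - {a} \<subseteq> A" using insert.prems(1) insert.hyps by auto
    have "bin_expect p (A - (B - {a})) (\<lambda>S. g (S \<union> (B - {a}))) = bin_expect p A g"
    proof (rule insert.IH[OF B])
      fix S T assume "S - (B - {a}) = T - (B - {a})"
      then show "g S = g T" by (intro insert.prems(2)) auto
    qed
    then show ?thesis
      using insert.hyps by (simp add: bin_expect_insert eq eq2[symmetric] 4 algebra_simps)
  next
    case False
    then have B: "B \<subseteq> A" and 1: "insert a A - B = insert a (A - B)"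
      using insert.prems(1) by auto
    have 2: "bin_expect p (A - B) (\<lambda>S. g (insert a (S \<union> B))) = bin_expect p A (\<lambda>S. g (insert a S))"
    proof (rule insert.IH[OF B])
      fix S T assume "S - B = T - B"
      then show "g (insert a S) = g (insert a T)" by (intro insert.prems(2)) auto
    qed
    have 3: "bin_expect p (A - B) (\<lambda>S. g (S \<union> B)) = bin_expect p A g"
      by (rule insert.IH[OF B insert.prems(2)])
    show ?thesis
      using 2 3 insert.hyps False
      by (simp add: bin_expect_insert 1)
  qed
qed simp

lemma bin_expect_card: "finite A \<Longrightarrow> bin_expect p A (\<lambda>S. real (card S)) = real (card A) * p"
proof (induction A rule: finite_induct)
  case (insert a A)
  have "bin_expect p A (\<lambda>S. real (card (insert a S))) = bin_expect p A (\<lambda>S. real (card S)) + 1"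
  proof -
    have "real (card (insert a S)) = real (card S) - (- 1)" if "S \<subseteq> A" for S
      using that insert.hyps finite_subset[of S A] by (subst card_insert_disjoint) auto
    then have "bin_expect p A (\<lambda>S. real (card (insert a S)))
        = bin_expect p A (\<lambda>S. real (card S) - (- 1))"
      by (rule bin_expect_cong)
    also have "\<dots> = bin_expect p A (\<lambda>S. real (card S)) - (- 1)"
      using insert.hyps by (simp only: bin_expect_diff bin_expect_const)
    finally show ?thesis by simp
  qed
  then show ?case
    using insert by (simp add: bin_expect_insert algebra_simps)
qed simp

subsection \<open>Janson's inequality\<close>

definition avoids :: "('i \<Rightarrow> 'e set) \<Rightarrow> 'i set \<Rightarrow> 'e set \<Rightarrow> real" where
  "avoids E I S = of_bool (\<forall>i\<in>I. \<not> E i \<subseteq> S)"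

lemma antimono_avoids: "antimono (avoids E I)"
proof (rule antimonoI)
  fix S T :: "'a set" assume "S \<subseteq> T"
  have "E i \<subseteq> T" if "E i \<subseteq> S" for i using that \<open>S \<subseteq> T\<close> by (rule subset_trans)
  then show "avoids E I T \<le> avoids E I S"
    unfolding avoids_def of_bool_less_eq_iff by blast
qed

lemma avoids_nonneg: "0 \<le> avoids E I S"
  by (simp add: avoids_def)

text \<open>Among the outcomes that avoid \<open>J\<close>, at least the stated fraction contain
  \<open>E i\<close>: avoiding the sets disjoint from \<open>E i\<close> is independent of
  \<open>E i \<subseteq> S\<close>, and each neighbour in \<open>D\<close> costs at most
  \<open>p ^ card (E i \<union> E j)\<close> by Harris' inequality.\<close>

lemma janson_step:
  assumes A: "finite A" and fin: "finite J" and i: "E i \<subseteq> A" and J: "\<And>j. j \<in> J \<Longrightarrow> E j \<subseteq> A"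
    and p: "0 \<le> p" "p \<le> 1"
  defines "D \<equiv> {j \<in> J. E i \<inter> E j \<noteq> {}}"
  shows "bin_expect p A (avoids E (insert i J))
    \<le> bin_expect p A (avoids E J) * (1 - (p ^ card (E i) - (\<Sum>j\<in>D. p ^ card (E i \<union> E j))))"
proof -
  define x where "x = p ^ card (E i) - (\<Sum>j\<in>D. p ^ card (E i \<union> E j))"
  define N where "N = avoids E J"
  define G where "G = avoids E (J - D)"
  have finD: "finite D" using fin by (simp add: D_def)
  have NG: "N S \<le> G S" for S by (auto simp: N_def G_def avoids_def)
  have split: "avoids E (insert i J) S = N S - (if E i \<subseteq> S then N S else 0)" for S
    by (auto simp: N_def avoids_def)
  \<comment> \<open>A union bound: when \<open>E i \<subseteq> S\<close>, the indicators
    \<open>N\<close> and \<open>G\<close> can differ only if some neighbour \<open>E j\<close> lies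
    in \<open>S\<close> too.\<close>
  have lower: "(if E i \<subseteq> S then G S else 0) - (\<Sum>j\<in>D. if E i \<union> E j \<subseteq> S then G S else 0)
      \<le> (if E i \<subseteq> S then N S else 0)" for S
  proof (cases "E i \<subseteq> S \<and> (\<exists>j\<in>D. E j \<subseteq> S)")
    case True
    then obtain j where j: "j \<in> D" "E j \<subseteq> S" by blast
    have "G S = (\<Sum>k\<in>{j}. if E i \<union> E k \<subseteq> S then G S else 0)"
      using True j by simp
    also have "\<dots> \<le> (\<Sum>k\<in>D. if E i \<union> E k \<subseteq> S then G S else 0)"
      using j finD by (intro sum_mono2) (auto simp: G_def avoids_nonneg)
    finally have "G S \<le> (\<Sum>k\<in>D. if E i \<union> E k \<subseteq> S then G S else 0)" .
    moreover have "0 \<le> N S" by (simp add: N_def avoids_nonneg)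
    ultimately show ?thesis using True by auto
  next
    case False
    then have "N S = G S" if "E i \<subseteq> S"
      using that by (auto simp: N_def G_def avoids_def)
    moreover have "0 \<le> (\<Sum>j\<in>D. if E i \<union> E j \<subseteq> S then G S else 0)"
      by (intro sum_nonneg) (auto simp: G_def avoids_nonneg)
    ultimately show ?thesis by auto
  qed
  have indep: "bin_expect p (A - E i) (\<lambda>S. G (S \<union> E i)) = bin_expect p A G"
  proof (rule bin_expect_indep[OF A i])
    fix S T assume ST: "S - E i = T - E i"
    have "E j \<subseteq> S \<longleftrightarrow> E j \<subseteq> T" if "j \<in> J - D" for j
      using that ST by (auto simp: D_def)
    then show "G S = G T" by (auto simp: G_def avoids_def)
  qed
  have harris: "bin_expect p A (\<lambda>S. if E i \<union> E j \<subseteq> S then G S else 0)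
      \<le> p ^ card (E i \<union> E j) * bin_expect p A G" if "j \<in> D" for j
  proof -
    have sub: "E i \<union> E j \<subseteq> A" using i J that by (auto simp: D_def)
    show ?thesis
      unfolding bin_expect_superset[OF A sub]
      using p by (intro mult_left_mono bin_expect_antimono A sub) (auto simp: G_def antimono_avoids)
  qed
  have "x * bin_expect p A G
      \<le> bin_expect p A (\<lambda>S. if E i \<subseteq> S then G S else 0)
        - (\<Sum>j\<in>D. bin_expect p A (\<lambda>S. if E i \<union> E j \<subseteq> S then G S else 0))"
    using sum_mono[OF harris]
    by (simp add: x_def bin_expect_superset[OF A i] indep algebra_simps sum_distrib_left)
  also have "\<dots> \<le> bin_expect p A (\<lambda>S. if E i \<subseteq> S then N S else 0)"
    unfolding bin_expect_sum[symmetric] bin_expect_diff[symmetric]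
    using p lower by (intro bin_expect_mono)
  finally have main: "x * bin_expect p A G \<le> bin_expect p A (\<lambda>S. if E i \<subseteq> S then N S else 0)" .
  have N0: "0 \<le> bin_expect p A N"
    using p by (intro bin_expect_nonneg) (auto simp: N_def avoids_nonneg)
  have "x * bin_expect p A N \<le> bin_expect p A (\<lambda>S. if E i \<subseteq> S then N S else 0)"
  \<comment> \<open>Replacing the mean of \<open>G\<close> by the smaller mean of \<open>N\<close>
    requires a nonnegative factor; for negative \<open>x\<close> the claim is trivial.\<close>
  proof (cases "0 \<le> x")
    case True
    have "x * bin_expect p A N \<le> x * bin_expect p A G"
      using p NG True by (intro mult_left_mono bin_expect_mono)
    with main show ?thesis by linarith
  next
    case False
    then have "x * bin_expect p A N \<le> 0" using N0 by (simp add: mult_nonpos_nonneg)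
    also have "0 \<le> bin_expect p A (\<lambda>S. if E i \<subseteq> S then N S else 0)"
      using p by (intro bin_expect_nonneg) (auto simp: N_def avoids_nonneg)
    finally show ?thesis .
  qed
  then show ?thesis
    unfolding split bin_expect_diff x_def[symmetric] N_def[symmetric] by (simp add: algebra_simps)
qed

text \<open>The sets are added one at a time, each contributing a factor
  \<open>1 - x \<le> exp (- x)\<close> by \<open>janson_step\<close>.\<close>

lemma janson_exp:
  assumes A: "finite A" and fin: "finite I" and E: "\<And>i. i \<in> I \<Longrightarrow> E i \<subseteq> A"
    and p: "0 \<le> p" "p \<le> 1"
  shows "bin_expect p A (avoids E I) \<le>
    exp (- (\<Sum>i\<in>I. p ^ card (E i)) +
      (\<Sum>(i, j) \<in> {(i, j) \<in> I \<times> I. i \<noteq> j \<and> E i \<inter> E j \<noteq> {}}. p ^ card (E i \<union> E j)))"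
  using fin E
proof (induction I rule: finite_induct)
  case empty
  then show ?case by (simp add: avoids_def bin_expect_const[OF A])
next
  case (insert i I)
  define P where "P = (\<lambda>I. {(i, j) \<in> I \<times> I. i \<noteq> j \<and> E i \<inter> E j \<noteq> {}})"
  define D where "D = {j \<in> I. E i \<inter> E j \<noteq> {}}"
  define f where "f = (\<lambda>(i, j). p ^ card (E i \<union> E j))"
  define x where "x = p ^ card (E i) - (\<Sum>j\<in>D. p ^ card (E i \<union> E j))"
  have "bin_expect p A (avoids E (insert i I)) \<le> bin_expect p A (avoids E I) * (1 - x)"
    unfolding x_def D_def using insert by (intro janson_step A p) auto
  also have "\<dots> \<le> bin_expect p A (avoids E I) * exp (- x)"
    using exp_ge_add_one_self[of "- x"] p
    by (intro mult_left_mono bin_expect_nonneg) (auto simp: avoids_nonneg)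
  also have "\<dots> \<le> exp (- (\<Sum>i\<in>I. p ^ card (E i)) + sum f (P I)) * exp (- x)"
    using insert by (intro mult_right_mono) (auto simp: P_def f_def)
  also have "\<dots> = exp (- (\<Sum>i\<in>insert i I. p ^ card (E i))
      + (sum f (P I) + (\<Sum>j\<in>D. p ^ card (E i \<union> E j))))"
    using insert by (simp add: exp_add[symmetric] x_def)
  also have "(\<Sum>j\<in>D. p ^ card (E i \<union> E j)) = sum f (Pair i ` D)"
    by (simp add: sum.reindex inj_on_def f_def)
  also have "sum f (P I) + sum f (Pair i ` D) = sum f (P I \<union> Pair i ` D)"
    using insert by (intro sum.union_disjoint[symmetric])
      (auto simp: P_def D_def intro: finite_subset[of _ "I \<times> I"])
  \<comment> \<open>The step yields only the pairs \<open>(i, j)\<close> with \<open>j\<close> in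
    \<open>D\<close>; the mirrored pairs \<open>(j, i)\<close> are added for free, so that the sum
    runs over all ordered pairs.\<close>
  also have "exp (- (\<Sum>i\<in>insert i I. p ^ card (E i)) + sum f (P I \<union> Pair i ` D))
      \<le> exp (- (\<Sum>i\<in>insert i I. p ^ card (E i)) + sum f (P (insert i I)))"
    unfolding exp_le_cancel_iff add_le_cancel_left using insert p
    by (intro sum_mono2)
      (auto simp: P_def D_def f_def intro: finite_subset[of _ "insert i I \<times> insert i I"])
  finally show ?case unfolding P_def f_def .
qed

text \<open>Averaging the exponent of \<open>janson_exp\<close> over a binomial random subfamily damps the
  correlation term by \<open>q\<^sup>2\<close> and the mean only by \<open>q\<close>.\<close>

lemma janson:
  assumes A: "finite A" and fin: "finite I" and E: "\<And>i. i \<in> I \<Longrightarrow> E i \<subseteq> A"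
    and p: "0 \<le> p" "p \<le> 1" and q: "0 \<le> q" "q \<le> 1"
  shows "bin_expect p A (avoids E I) \<le>
    exp (- (q * (\<Sum>i\<in>I. p ^ card (E i))) + q\<^sup>2 *
      (\<Sum>(i, j) \<in> {(i, j) \<in> I \<times> I. i \<noteq> j \<and> E i \<inter> E j \<noteq> {}}. p ^ card (E i \<union> E j)))"
    (is "?P \<le> exp ?R")
proof (cases "?P \<le> 0")
  case True
  then show ?thesis by (rule order_trans) simp
next
  case False
  define P where "P = (\<lambda>I. {(i, j) \<in> I \<times> I. i \<noteq> j \<and> E i \<inter> E j \<noteq> {}})"
  define f where "f = (\<lambda>(i, j). p ^ card (E i \<union> E j))"
  have finP: "finite (P I)"
    using fin by (auto simp: P_def intro: finite_subset[of _ "I \<times> I"])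
  \<comment> \<open>Dropping sets makes avoidance likelier, so \<open>?P\<close> is bounded by the
    estimate for every subfamily \<open>J\<close>. The indicators turn that estimate into a function
    of \<open>J\<close> whose mean can be taken termwise.\<close>
  have ln_le: "ln ?P \<le> (\<Sum>k\<in>P I. f k * of_bool (case k of (i, j) \<Rightarrow> {i, j} \<subseteq> J))
      - (\<Sum>i\<in>I. p ^ card (E i) * of_bool ({i} \<subseteq> J))" if J: "J \<subseteq> I" for J
  proof -
    have "?P \<le> bin_expect p A (avoids E J)"
      using p J by (intro bin_expect_mono) (auto simp: avoids_def)
    also have "\<dots> \<le> exp (- (\<Sum>i\<in>J. p ^ card (E i)) + sum f (P J))"
      unfolding P_def f_def using J E fin by (intro janson_exp A p) (auto intro: finite_subset)
    finally have "ln ?P \<le> - (\<Sum>i\<in>J. p ^ card (E i)) + sum f (P J)"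
      using False by (metis exp_gt_zero ln_exp ln_le_cancel_iff not_le)
    also have "(\<Sum>i\<in>J. p ^ card (E i)) = (\<Sum>i\<in>I. p ^ card (E i) * of_bool ({i} \<subseteq> J))"
      using J fin by (intro sum.mono_neutral_cong_left) auto
    also have "sum f (P J) = (\<Sum>k\<in>P I. f k * of_bool (case k of (i, j) \<Rightarrow> {i, j} \<subseteq> J))"
      using J finP by (intro sum.mono_neutral_cong_left) (auto simp: P_def)
    finally show ?thesis by simp
  qed
  have sub: "bin_expect q I (\<lambda>J. of_bool (B \<subseteq> J)) = q ^ card B" if "B \<subseteq> I" for B
    using bin_expect_superset[OF fin that, of q "\<lambda>_. 1"] fin
    by (simp add: bin_expect_const of_bool_def)
  have "ln ?P = bin_expect q I (\<lambda>_. ln ?P)" by (simp add: bin_expect_const fin)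
  also have "\<dots> \<le> bin_expect q I (\<lambda>J. (\<Sum>k\<in>P I. f k * of_bool (case k of (i, j) \<Rightarrow> {i, j} \<subseteq> J))
      - (\<Sum>i\<in>I. p ^ card (E i) * of_bool ({i} \<subseteq> J)))"
    using q ln_le by (intro bin_expect_mono)
  also have "\<dots> = (\<Sum>k\<in>P I. f k * bin_expect q I (\<lambda>J. of_bool (case k of (i, j) \<Rightarrow> {i, j} \<subseteq> J)))
      - (\<Sum>i\<in>I. p ^ card (E i) * bin_expect q I (\<lambda>J. of_bool ({i} \<subseteq> J)))"
    by (simp only: bin_expect_diff bin_expect_sum bin_expect_cmult)
  also have "(\<Sum>k\<in>P I. f k * bin_expect q I (\<lambda>J. of_bool (case k of (i, j) \<Rightarrow> {i, j} \<subseteq> J)))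
      = (\<Sum>k\<in>P I. f k * q\<^sup>2)"
  proof (rule sum.cong[OF refl])
    fix k assume "k \<in> P I"
    then obtain i j where k: "k = (i, j)" "{i, j} \<subseteq> I" "i \<noteq> j" by (auto simp: P_def)
    show "f k * bin_expect q I (\<lambda>J. of_bool (case k of (i, j) \<Rightarrow> {i, j} \<subseteq> J)) = f k * q\<^sup>2"
      using sub[OF k(2)] k by (simp add: power2_eq_square)
  qed
  also have "(\<Sum>i\<in>I. p ^ card (E i) * bin_expect q I (\<lambda>J. of_bool ({i} \<subseteq> J)))
      = (\<Sum>i\<in>I. p ^ card (E i) * q)"
  proof (rule sum.cong[OF refl])
    fix i assume "i \<in> I"
    then show "p ^ card (E i) * bin_expect q I (\<lambda>J. of_bool ({i} \<subseteq> J)) = p ^ card (E i) * q"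
      using sub[of "{i}"] by simp
  qed
  finally have "ln ?P \<le> ?R"
    by (simp add: P_def f_def sum_distrib_left sum_distrib_right mult.commute)
  then have "exp (ln ?P) \<le> exp ?R" by (simp only: exp_le_cancel_iff)
  then show ?thesis using False by (simp only: exp_ln not_le)
qed

text \<open>The exponent \<open>- q \<mu> + \<kappa> (q \<mu>)^2\<close> is smallest at
  \<open>q = 1 / (2 \<kappa> \<mu>)\<close>, with value \<open>- 1 / (4 \<kappa>)\<close>. The
  hypothesis \<open>1 \<le> 2 * \<kappa> * \<mu>\<close> makes this \<open>q\<close> a
  probability.\<close>

lemma janson_quadratic:
  assumes A: "finite A" and fin: "finite I" and E: "\<And>i. i \<in> I \<Longrightarrow> E i \<subseteq> A"
    and p: "0 \<le> p" "p \<le> 1"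
  defines "\<mu> \<equiv> \<Sum>i\<in>I. p ^ card (E i)"
  assumes \<kappa>: "0 < \<kappa>" "1 \<le> 2 * \<kappa> * \<mu>"
    and \<Delta>: "(\<Sum>(i, j) \<in> {(i, j) \<in> I \<times> I. i \<noteq> j \<and> E i \<inter> E j \<noteq> {}}. p ^ card (E i \<union> E j)) \<le> \<kappa> * \<mu>\<^sup>2"
      (is "?D \<le> _")
  shows "bin_expect p A (avoids E I) \<le> exp (- (1 / (4 * \<kappa>)))"
proof -
  define q where "q = 1 / (2 * \<kappa> * \<mu>)"
  have q: "0 \<le> q" "q \<le> 1" using \<kappa> by (auto simp: q_def)
  have \<mu>0: "0 < \<mu>" using \<kappa> by (smt (verit) mult_nonneg_nonpos zero_less_mult_iff)
  have "bin_expect p A (avoids E I) \<le> exp (- (q * \<mu>) + q\<^sup>2 * ?D)"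
    unfolding \<mu>_def by (intro janson A fin E p q)
  also have "\<dots> \<le> exp (- (q * \<mu>) + q\<^sup>2 * (\<kappa> * \<mu>\<^sup>2))"
    using \<Delta> by (simp add: mult_left_mono)
  also have "- (q * \<mu>) + q\<^sup>2 * (\<kappa> * \<mu>\<^sup>2) = - (1 / (4 * \<kappa>))"
    using \<kappa> \<mu>0 by (simp add: q_def field_simps power2_eq_square)
  finally show ?thesis .
qed

subsection \<open>Initial segments of random permutations\<close>

lemma card_permutations_take_eq:
  assumes A: "finite A" and S: "S \<subseteq> A"
  shows "card {es \<in> permutations_of_set A. set (take (card S) es) = S}
    = fact (card S) * fact (card A - card S)"
proof -
  have fin: "finite S" using A S finite_subset by auto
  have "bij_betw (\<lambda>(xs, ys). xs @ ys) (permutations_of_set S \<times> permutations_of_set (A - S))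
    {es \<in> permutations_of_set A. set (take (card S) es) = S}"
  proof (rule bij_betwI[where g = "\<lambda>es. (take (card S) es, drop (card S) es)"])
    show "(\<lambda>(xs, ys). xs @ ys) \<in> permutations_of_set S \<times> permutations_of_set (A - S)
      \<rightarrow> {es \<in> permutations_of_set A. set (take (card S) es) = S}"
      using S by (auto simp: permutations_of_set_def distinct_card[symmetric])
    show "(\<lambda>es. (take (card S) es, drop (card S) es))
      \<in> {es \<in> permutations_of_set A. set (take (card S) es) = S}
        \<rightarrow> permutations_of_set S \<times> permutations_of_set (A - S)"
    proof (intro funcsetI)
      fix es assume es: "es \<in> {es \<in> permutations_of_set A. set (take (card S) es) = S}"
      have "set es = set (take (card S) es) \<union> set (drop (card S) es)"
        by (metis append_take_drop_id set_append)
      moreover have "set (take (card S) es) \<inter> set (drop (card S) es) = {}"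
        using es by (intro set_take_disj_set_drop_if_distinct) (auto simp: permutations_of_set_def)
      ultimately show "(take (card S) es, drop (card S) es) \<in> permutations_of_set S \<times> permutations_of_set (A - S)"
        using es by (auto simp: permutations_of_set_def)
    qed
  qed (auto simp: permutations_of_set_def distinct_card)
  then have "card {es \<in> permutations_of_set A. set (take (card S) es) = S}
     = card (permutations_of_set S \<times> permutations_of_set (A - S))"
    by (simp add: bij_betw_same_card)
  also have "\<dots> = fact (card S) * fact (card A - card S)"
    using A S fin by (simp add: card_cartesian_product card_Diff_subset)
  finally show ?thesis .
qed

text \<open>Each \<open>k\<close>-set is the initial segment of equally many orders, so the first
  \<open>k\<close> entries form a uniformly random \<open>k\<close>-set.\<close>

lemma card_permutations_take:
  assumes A: "finite A" and k: "k \<le> card A"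
  shows "card {es \<in> permutations_of_set A. Q (set (take k es))}
    = card {S. S \<subseteq> A \<and> card S = k \<and> Q S} * (fact k * fact (card A - k))"
proof -
  let ?X = "{S. S \<subseteq> A \<and> card S = k \<and> Q S}"
  let ?f = "\<lambda>S. {es \<in> permutations_of_set A. set (take k es) = S}"
  have "{es \<in> permutations_of_set A. Q (set (take k es))} = (\<Union>S\<in>?X. ?f S)" (is "?L = ?R")
  proof
    show "?L \<subseteq> ?R"
    proof
      fix es assume es: "es \<in> ?L"
      have "card (set (take k es)) = k"
        using es k by (subst distinct_card)
          (auto simp: permutations_of_set_def distinct_card[symmetric])
      then show "es \<in> ?R" using es
        by (auto simp: permutations_of_set_def dest: in_set_takeD)
    qed
  qed auto
  also have "card \<dots> = (\<Sum>S\<in>?X. card (?f S))"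
    using A by (intro card_UN_disjoint) (auto intro: finite_subset[of _ "Pow A"])
  also have "\<dots> = (\<Sum>S\<in>?X. fact k * fact (card A - k))"
  proof (rule sum.cong[OF refl])
    fix S assume "S \<in> ?X"
    then show "card (?f S) = fact k * fact (card A - k)"
      using card_permutations_take_eq[OF A, of S] by auto
  qed
  finally show ?thesis by simp
qed

text \<open>Sets of equal size have equal weight, so the binomial model is a mixture of uniform
  \<open>k\<close>-sets. This is the bridge to initial segments of random orders.\<close>

lemma bin_expect_by_card:
  assumes "finite A"
  shows "bin_expect p A (\<lambda>S. of_bool (card S \<le> t \<and> Q S))
    = (\<Sum>k\<le>t. p ^ k * (1 - p) ^ (card A - k) * real (card {S. S \<subseteq> A \<and> card S = k \<and> Q S}))"
proof -
  let ?X = "{S \<in> Pow A. card S \<le> t \<and> Q S}"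
  have "bin_expect p A (\<lambda>S. of_bool (card S \<le> t \<and> Q S))
      = (\<Sum>S\<in>?X. p ^ card S * (1 - p) ^ card (A - S))"
    unfolding bin_expect_def using assms by (intro sum.mono_neutral_cong_right) auto
  also have "\<dots> = (\<Sum>k\<le>t. \<Sum>S\<in>{S \<in> ?X. card S = k}. p ^ card S * (1 - p) ^ card (A - S))"
    using assms by (intro sum.group[symmetric]) auto
  also have "\<dots> = (\<Sum>k\<le>t. p ^ k * (1 - p) ^ (card A - k) * real (card {S. S \<subseteq> A \<and> card S = k \<and> Q S}))"
  proof (rule sum.cong[OF refl])
    fix k assume "k \<in> {..t}"
    then have eq: "{S \<in> ?X. card S = k} = {S. S \<subseteq> A \<and> card S = k \<and> Q S}" by auto
    have "(\<Sum>S\<in>{S \<in> ?X. card S = k}. p ^ card S * (1 - p) ^ card (A - S))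
      = (\<Sum>S\<in>{S. S \<subseteq> A \<and> card S = k \<and> Q S}. p ^ k * (1 - p) ^ (card A - k))"
      unfolding eq using assms
      by (intro sum.cong) (auto simp: card_Diff_subset finite_subset)
    then show "(\<Sum>S\<in>{S \<in> ?X. card S = k}. p ^ card S * (1 - p) ^ card (A - S))
      = p ^ k * (1 - p) ^ (card A - k) * real (card {S. S \<subseteq> A \<and> card S = k \<and> Q S})" by simp
  qed
  finally show ?thesis .
qed

text \<open>By Markov's inequality a binomial random subset of mean size \<open>t / 2\<close> has at most
  \<open>t\<close> elements with probability at least \<open>1 / 2\<close>.\<close>

lemma card_permutations_take_le_bin_expect:
  assumes A: "finite A" and t: "0 < t" "t \<le> card A"
    and Q: "\<And>S T. S \<subseteq> T \<Longrightarrow> Q T \<Longrightarrow> Q S"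
  shows "real (card {es \<in> permutations_of_set A. Q (set (take t es))})
    \<le> 2 * fact (card A) * bin_expect (real t / (2 * real (card A))) A (\<lambda>S. of_bool (Q S))"
proof -
  define N where "N = card A"
  define p where "p = real t / (2 * real N)"
  define c where "c = (\<lambda>k. real (card {es \<in> permutations_of_set A. Q (set (take k es))}))"
  have N: "0 < N" "t \<le> N" using t by (auto simp: N_def)
  have p: "0 \<le> p" "p \<le> 1" using N by (auto simp: p_def field_simps)
  have c_anti: "c t \<le> c k" if "k \<le> t" for k
    unfolding c_def using that Q[OF set_take_subset_set_take]
    by (intro of_nat_mono card_mono) auto
  \<comment> \<open>\<open>c k / fact N\<close> is the proportion of \<open>k\<close>-sets with
    \<open>Q\<close>, and it is at least \<open>c t / fact N\<close>. The conjunct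
    \<open>True\<close> keeps the set of all \<open>k\<close>-sets in the shape of the counting
    lemmas.\<close>
  have binom: "c t * real (card {S. S \<subseteq> A \<and> card S = k \<and> True})
      \<le> fact N * real (card {S. S \<subseteq> A \<and> card S = k \<and> Q S})" if "k \<le> t" for k
  proof -
    have k: "k \<le> card A" using that t by simp
    let ?g = "fact k * fact (N - k) :: real"
    have 1: "c k = real (card {S. S \<subseteq> A \<and> card S = k \<and> Q S}) * ?g"
      unfolding c_def N_def card_permutations_take[OF A k] by simp
    have "fact N = real (card {es \<in> permutations_of_set A. True})" using A by (simp add: N_def)
    then have 2: "fact N = real (card {S. S \<subseteq> A \<and> card S = k \<and> True}) * ?g"
      unfolding N_def card_permutations_take[OF A k, of "\<lambda>_. True"] by simp
    have "c t * real (card {S. S \<subseteq> A \<and> card S = k \<and> True})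
      \<le> c k * real (card {S. S \<subseteq> A \<and> card S = k \<and> True})"
      using c_anti[OF that] by (intro mult_right_mono) auto
    then show ?thesis unfolding 1 2 by (simp add: mult_ac)
  qed
  \<comment> \<open>Markov's inequality pointwise: \<open>1 - card S / t\<close> is at most the
    indicator of \<open>card S \<le> t\<close>, and its mean is \<open>1 / 2\<close>.\<close>
  have "1 / 2 = 1 - bin_expect p A (\<lambda>S. real (card S)) / real t"
    using t N by (simp add: bin_expect_card[OF A] p_def N_def)
  also have "\<dots> = bin_expect p A (\<lambda>S. 1 - 1 / real t * real (card S))"
    by (simp only: bin_expect_diff bin_expect_cmult bin_expect_const[OF A]) simp
  also have "\<dots> \<le> bin_expect p A (\<lambda>S. of_bool (card S \<le> t \<and> True))"
    using p t by (intro bin_expect_mono) (auto simp: field_simps)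
  finally have "c t * (1 / 2) \<le> c t * bin_expect p A (\<lambda>S. of_bool (card S \<le> t \<and> True))"
    by (intro mult_left_mono) (auto simp: c_def)
  also have "\<dots> = (\<Sum>k\<le>t. p ^ k * (1 - p) ^ (N - k) * (c t * real (card {S. S \<subseteq> A \<and> card S = k \<and> True})))"
    unfolding bin_expect_by_card[OF A] sum_distrib_left N_def by (simp only: mult_ac)
  also have "\<dots> \<le> (\<Sum>k\<le>t. p ^ k * (1 - p) ^ (N - k) * (fact N * real (card {S. S \<subseteq> A \<and> card S = k \<and> Q S})))"
    using p by (intro sum_mono mult_left_mono binom) auto
  also have "\<dots> = fact N * bin_expect p A (\<lambda>S. of_bool (card S \<le> t \<and> Q S))"
    unfolding bin_expect_by_card[OF A] sum_distrib_left N_def by (simp only: mult_ac)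
  also have "\<dots> \<le> fact N * bin_expect p A (\<lambda>S. of_bool (Q S))"
    using p by (intro mult_left_mono bin_expect_mono) auto
  finally show ?thesis by (simp add: c_def p_def N_def)
qed

text \<open>Sampling without replacement: once \<open>b\<close> elements are known to be among the
  first \<open>t\<close>, the next one is there with probability \<open>(t - b) / (N - b)\<close>,
  which is at most \<open>t / N\<close> because \<open>t \<le> N\<close>. The ratio comes from the
  absorption identity for binomial coefficients.\<close>

lemma card_permutations_take_superset:
  assumes A: "finite A" and t: "t \<le> card A" and B: "B \<subseteq> A"
  shows "real (card {es \<in> permutations_of_set A. B \<subseteq> set (take t es)})
    \<le> fact (card A) * (real t / real (card A)) ^ card B"
  using finite_subset[OF B A] B
proof (induction B rule: finite_induct)
  case empty
  then show ?case using A by simp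
next
  case (insert a B)
  define N where "N = card A"
  define b where "b = card B"
  define n where "n = (\<lambda>B. card {S. S \<subseteq> A \<and> card S = t \<and> B \<subseteq> S})"
  have finB: "finite B" "B \<subseteq> A" "a \<in> A" using insert by auto
  have bN: "b < N"
    using psubset_card_mono[OF A, of B] insert by (auto simp: b_def N_def)
  have count: "n C = (N - card C) choose (t - card C)" if "C \<subseteq> A" "card C \<le> t" for C
  proof -
    have finC: "finite C" using that A finite_subset by auto
    have "bij_betw (\<lambda>S. S \<union> C) {S. S \<subseteq> A - C \<and> card S = t - card C}
      {S. S \<subseteq> A \<and> card S = t \<and> C \<subseteq> S}"
    proof (rule bij_betwI[where g = "\<lambda>S. S - C"])
      show "(\<lambda>S. S \<union> C) \<in> {S. S \<subseteq> A - C \<and> card S = t - card C} \<rightarrow> {S. S \<subseteq> A \<and> card S = t \<and> C \<subseteq> S}"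
      proof (intro funcsetI)
        fix S assume S: "S \<in> {S. S \<subseteq> A - C \<and> card S = t - card C}"
        then have "card (S \<union> C) = card S + card C"
          using finC A by (intro card_Un_disjoint) (auto intro: finite_subset)
        then show "S \<union> C \<in> {S. S \<subseteq> A \<and> card S = t \<and> C \<subseteq> S}"
          using S that by auto
      qed
      show "(\<lambda>S. S - C) \<in> {S. S \<subseteq> A \<and> card S = t \<and> C \<subseteq> S} \<rightarrow> {S. S \<subseteq> A - C \<and> card S = t - card C}"
        using finC by (auto simp: card_Diff_subset)
    qed auto
    then have "n C = card {S. S \<subseteq> A - C \<and> card S = t - card C}"
      unfolding n_def by (simp add: bij_betw_same_card)
    also have "\<dots> = (N - card C) choose (t - card C)"
      using n_subsets[of "A - C"] A finC that by (simp add: card_Diff_subset N_def)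
    finally show ?thesis by simp
  qed
  have perm: "real (card {es \<in> permutations_of_set A. C \<subseteq> set (take t es)})
      = real (n C) * (fact t * fact (N - t))" for C
    unfolding n_def N_def card_permutations_take[OF A t] by simp
  have step: "real (n (insert a B)) \<le> real (n B) * (real t / real N)"
  proof (cases "b < t")
    case True
    define N' t' where "N' = N - Suc b" and "t' = t - Suc b"
    have N't': "N - b = Suc N'" "t - b = Suc t'" using True bN by (auto simp: N'_def t'_def)
    have "n B = Suc N' choose Suc t'"
      unfolding N't'[symmetric] using count[of B] insert True by (simp add: b_def)
    moreover have "n (insert a B) = N' choose t'"
      using count[of "insert a B"] insert True by (simp add: b_def N'_def t'_def)
    ultimately have "(t - b) * n B = (N - b) * n (insert a B)"
      unfolding N't' by (simp only: Suc_times_binomial_eq mult.commute[of "Suc t'"])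
    then have "real (N - b) * real (n (insert a B)) = real (t - b) * real (n B)"
      by (metis of_nat_mult)
    moreover have "real (N - b) > 0" using bN by simp
    ultimately have "real (n (insert a B)) = real (n B) * (real (t - b) / real (N - b))"
      by (simp add: field_simps)
    also have "real (t - b) / real (N - b) \<le> real t / real N"
    proof -
      have "real b * real t \<le> real b * real N"
        using t by (intro mult_left_mono) (auto simp: N_def)
      then have "(real t - real b) * real N \<le> real t * (real N - real b)"
        by (simp add: algebra_simps)
      then show ?thesis using True bN by (simp add: of_nat_diff field_simps)
    qed
    finally show ?thesis by (simp add: mult_left_mono)
  next
    case False
    have "{S. S \<subseteq> A \<and> card S = t \<and> insert a B \<subseteq> S} = {}"
    proof safe
      fix S assume S: "S \<subseteq> A" "insert a B \<subseteq> S" "t = card S"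
      then have "Suc b \<le> card S"
        using card_mono[of S "insert a B"] A finite_subset[of S A] insert.hyps by (simp add: b_def)
      then show "S \<in> {}" using False S by simp
    qed
    then have "n (insert a B) = 0" unfolding n_def by (simp only: card.empty)
    then show ?thesis by simp
  qed
  have IH: "real (n B) * (fact t * fact (N - t)) \<le> fact N * (real t / real N) ^ b"
    using insert.IH finB unfolding perm N_def b_def by blast
  have "real (n (insert a B)) * (fact t * fact (N - t))
      \<le> (real (n B) * (fact t * fact (N - t))) * (real t / real N)"
    using mult_right_mono[OF step, of "fact t * fact (N - t)"] by (simp add: mult_ac)
  also have "\<dots> \<le> fact N * (real t / real N) ^ b * (real t / real N)"
    by (intro mult_right_mono IH) auto
  finally show ?case
    using insert unfolding perm by (simp add: N_def b_def mult_ac)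
qed

text \<open>Exponential moment method: \<open>2 ^ card X\<close> is the number of subsets of \<open>X\<close>.\<close>

lemma card_permutations_take_Int_gt:
  assumes A: "finite A" and t: "t \<le> card A" and B: "B \<subseteq> A"
  shows "real (card {es \<in> permutations_of_set A. b < real (card (set (take t es) \<inter> B))})
    \<le> fact (card A) * (2 powr (- b) * exp (real t * real (card B) / real (card A)))"
proof -
  define x where "x = real t / real (card A)"
  let ?X = "{es \<in> permutations_of_set A. b < real (card (set (take t es) \<inter> B))}"
  have finB: "finite B" using A B finite_subset by auto
  \<comment> \<open>Markov's inequality for the weight
    \<open>2 ^ card (set (take t es) \<inter> B)\<close>, which is at least \<open>2 powr b\<close>
    on every bad order.\<close>
  have "real (card ?X) * 2 powr b = (\<Sum>es\<in>?X. 2 powr b)" by simp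
  also have "\<dots> \<le> (\<Sum>es\<in>?X. 2 ^ card (set (take t es) \<inter> B))"
    by (intro sum_mono) (auto simp: powr_realpow[symmetric])
  also have "\<dots> \<le> (\<Sum>es\<in>permutations_of_set A. 2 ^ card (set (take t es) \<inter> B))"
    by (intro sum_mono2) auto
  also have "\<dots> = (\<Sum>es\<in>permutations_of_set A. \<Sum>C\<in>Pow B. of_bool (C \<subseteq> set (take t es)))"
  proof (rule sum.cong[OF refl])
    fix es
    have "(\<Sum>C\<in>Pow B. of_bool (C \<subseteq> set (take t es)) :: real)
        = (\<Sum>C\<in>Pow (set (take t es) \<inter> B). 1)"
      using finB by (intro sum.mono_neutral_cong_right) auto
    also have "\<dots> = 2 ^ card (set (take t es) \<inter> B)"
      using finB by (subst sum_constant, subst card_Pow) auto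
    finally show "2 ^ card (set (take t es) \<inter> B) = (\<Sum>C\<in>Pow B. of_bool (C \<subseteq> set (take t es)) :: real)"
      by (rule sym)
  qed
  also have "\<dots> = (\<Sum>C\<in>Pow B. \<Sum>es\<in>permutations_of_set A. of_bool (C \<subseteq> set (take t es)))"
    by (rule sum.swap)
  also have "\<dots> = (\<Sum>C\<in>Pow B. real (card {es \<in> permutations_of_set A. C \<subseteq> set (take t es)}))"
    by (simp add: sum.If_cases of_bool_def Int_def)
  also have "\<dots> \<le> (\<Sum>C\<in>Pow B. fact (card A) * x ^ card C)"
    unfolding x_def using B by (intro sum_mono card_permutations_take_superset A t) auto
  also have "\<dots> = fact (card A) * (1 + x) ^ card B"
    using prod_add[OF finB, of "\<lambda>_. x" "\<lambda>_. 1"] by (simp add: sum_distrib_left add.commute)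
  also have "\<dots> \<le> fact (card A) * exp x ^ card B"
    using exp_ge_add_one_self[of x] by (intro mult_left_mono power_mono) (auto simp: x_def)
  also have "exp x ^ card B = exp (real t * real (card B) / real (card A))"
    by (simp add: exp_of_nat_mult[symmetric] x_def mult_ac)
  finally show ?thesis by (simp add: powr_minus field_simps)
qed

subsection \<open>Correlation of copies of a graph\<close>

definition induced_edges :: "'a graph \<Rightarrow> 'a set \<Rightarrow> 'a set set" where
  "induced_edges F T = {e \<in> edges F. e \<subseteq> T}"

definition copy_edges :: "'a graph \<Rightarrow> ('a \<Rightarrow> 'v) \<Rightarrow> 'v set set" where
  "copy_edges F \<phi> = (\<lambda>e. \<phi> ` e) ` edges F"

lemma simple_graph_finite:
  assumes "simple_graph F"
  shows "finite (verts F)" "finite (edges F)" "\<And>e. e \<in> edges F \<Longrightarrow> e \<subseteq> verts F \<and> card e = 2"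
proof -
  show "finite (verts F)" "finite (edges F)"
    using assms by (auto simp: simple_graph_def intro: finite_subset finite_imp_finite_nsets)
  show "e \<subseteq> verts F \<and> card e = 2" if "e \<in> edges F" for e
    using assms that by (auto simp: simple_graph_def nsets_def)
qed

lemma partite_inj_on:
  assumes "\<phi> \<in> PiE V W"
    and "\<And>x y. x \<in> V \<Longrightarrow> y \<in> V \<Longrightarrow> x \<noteq> y \<Longrightarrow> W x \<inter> W y = {}"
  shows "inj_on \<phi> V"
proof (rule inj_onI)
  fix x y assume xy: "x \<in> V" "y \<in> V" "\<phi> x = \<phi> y"
  then have "\<phi> x \<in> W x \<inter> W y" using assms(1) by (auto simp: PiE_iff)
  then show "x = y" using assms(2)[of x y] xy by auto
qed

lemma card_copy_edges:
  assumes "simple_graph F" "inj_on \<phi> (verts F)"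
  shows "card (copy_edges F \<phi>) = card (edges F)"
  unfolding copy_edges_def
proof (rule card_image)
  show "inj_on ((`) \<phi>) (edges F)"
    using simple_graph_finite[OF assms(1)] inj_on_image_Pow[OF assms(2)]
    by (auto intro: inj_on_subset)
qed

text \<open>The piece containing a vertex reveals which vertex of \<open>F\<close> it is the image
  of. A shared edge is therefore the image of one and the same edge of \<open>F\<close> under both
  maps, and overlaps are described by vertex subsets of \<open>F\<close>.\<close>

lemma copy_edges_Int:
  assumes F: "simple_graph F"
    and \<phi>: "\<phi> \<in> PiE (verts F) W" and \<psi>: "\<psi> \<in> PiE (verts F) W"
    and disj: "\<And>x y. x \<in> verts F \<Longrightarrow> y \<in> verts F \<Longrightarrow> x \<noteq> y \<Longrightarrow> W x \<inter> W y = {}"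
  shows "copy_edges F \<phi> \<inter> copy_edges F \<psi>
    \<subseteq> (\<lambda>e. \<phi> ` e) ` induced_edges F {x \<in> verts F. \<phi> x = \<psi> x}"
proof
  fix e assume "e \<in> copy_edges F \<phi> \<inter> copy_edges F \<psi>"
  then obtain a b where ab: "a \<in> edges F" "b \<in> edges F" "e = \<phi> ` a" "e = \<psi> ` b"
    by (auto simp: copy_edges_def)
  have "x \<in> verts F \<and> \<phi> x = \<psi> x" if x: "x \<in> a" for x
  proof -
    have "\<phi> x \<in> \<psi> ` b" using ab x by blast
    then obtain y where y: "y \<in> b" "\<phi> x = \<psi> y" by auto
    have V: "x \<in> verts F" "y \<in> verts F"
      using x y ab simple_graph_finite(3)[OF F] by auto
    then have "\<phi> x \<in> W x \<inter> W y" using \<phi> \<psi> y by (auto simp: PiE_iff)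
    then have "x = y" using disj[OF V] by auto
    then show ?thesis using y V by simp
  qed
  then have "a \<in> induced_edges F {x \<in> verts F. \<phi> x = \<psi> x}"
    using ab by (auto simp: induced_edges_def)
  then show "e \<in> (\<lambda>e. \<phi> ` e) ` induced_edges F {x \<in> verts F. \<phi> x = \<psi> x}"
    using ab by blast
qed

lemma card_PiE_agree:
  assumes "finite V" "T \<subseteq> V" "\<phi> \<in> PiE V W" "\<And>x. x \<in> V \<Longrightarrow> card (W x) = r"
  shows "card {\<psi> \<in> PiE V W. \<forall>x\<in>T. \<psi> x = \<phi> x} = r ^ (card V - card T)"
proof -
  have "(\<forall>x\<in>V. \<psi> x \<in> (if x \<in> T then {\<phi> x} else W x)) \<longleftrightarrow>
      (\<forall>x\<in>V. \<psi> x \<in> W x) \<and> (\<forall>x\<in>T. \<psi> x = \<phi> x)" for \<psi>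
  proof -
    have "x \<in> V \<and> \<phi> x \<in> W x" if "x \<in> T" for x
      using that assms(2,3) by (auto simp: PiE_iff)
    then show ?thesis by auto
  qed
  then have "{\<psi> \<in> PiE V W. \<forall>x\<in>T. \<psi> x = \<phi> x} = PiE V (\<lambda>x. if x \<in> T then {\<phi> x} else W x)"
    unfolding PiE_iff set_eq_iff mem_Collect_eq by blast
  also have "card \<dots> = (\<Prod>x\<in>V. if x \<in> T then 1 else r)"
    using assms by (subst card_PiE) (auto intro!: prod.cong)
  also have "\<dots> = r ^ (card V - card T)"
  proof -
    have "V \<inter> {x. x \<notin> T} = V - T" by auto
    then show ?thesis
      using assms(1,2) by (simp add: prod.If_cases card_Diff_subset finite_subset Compl_eq)
  qed
  finally show ?thesis .
qed

text \<open>The maps \<open>\<psi>\<close> are sorted by the set \<open>T\<close> on which they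
  agree with \<open>\<phi>\<close>. There are \<open>r ^ (v - card T)\<close> maps agreeing on
  \<open>T\<close>, and a pair whose exact agreement set is \<open>T\<close> covers at least
  \<open>2 m - e T\<close> edges. Each \<open>T\<close> thus contributes at most
  \<open>r ^ v * p ^ (2 * m)\<close> divided by \<open>r ^ card T * p ^ e T\<close>, and there are
  at most \<open>2 ^ v\<close> sets \<open>T\<close>.\<close>

lemma copies_correlation:
  fixes F :: "'a graph" and W :: "'a \<Rightarrow> 'v set"
  assumes F: "simple_graph F" and p: "0 < p" "p \<le> 1" and r: "0 < r"
    and W: "\<And>x. x \<in> verts F \<Longrightarrow> card (W x) = r"
    and disj: "\<And>x y. x \<in> verts F \<Longrightarrow> y \<in> verts F \<Longrightarrow> x \<noteq> y \<Longrightarrow> W x \<inter> W y = {}"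
    and c: "0 < c" and dense: "\<And>T. T \<subseteq> verts F \<Longrightarrow> induced_edges F T \<noteq> {} \<Longrightarrow>
      c \<le> real r ^ card T * p ^ card (induced_edges F T)"
    and \<phi>: "\<phi> \<in> PiE (verts F) W"
  shows "(\<Sum>\<psi> \<in> {\<psi> \<in> PiE (verts F) W. copy_edges F \<phi> \<inter> copy_edges F \<psi> \<noteq> {}}.
      p ^ card (copy_edges F \<phi> \<union> copy_edges F \<psi>))
    \<le> 2 ^ card (verts F) * (real r ^ card (verts F) * p ^ (2 * card (edges F)) / c)"
proof -
  define V where "V = verts F"
  define e where "e = (\<lambda>T. card (induced_edges F T))"
  define m where "m = card (edges F)"
  define \<T> where "\<T> = {T \<in> Pow V. induced_edges F T \<noteq> {}}"
  define X where "X = {\<psi> \<in> PiE V W. copy_edges F \<phi> \<inter> copy_edges F \<psi> \<noteq> {}}"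
  define A where "A = (\<lambda>T. {\<psi> \<in> PiE V W. \<forall>x\<in>T. \<psi> x = \<phi> x})"
  note fin = simple_graph_finite[OF F]
  have finPi: "finite (PiE V W)"
    using fin(1) W r card_ge_0_finite by (auto simp: V_def intro!: finite_PiE)
  \<comment> \<open>Each \<open>\<psi>\<close> is charged to its exact agreement set, which spans an
    edge because the copies share one. \<open>A T\<close> asks for agreement at least on
    \<open>T\<close>, so the sum overcounts, which is harmless for an upper bound.\<close>
  have bound: "p ^ card (copy_edges F \<phi> \<union> copy_edges F \<psi>)
      \<le> (\<Sum>T\<in>\<T>. of_bool (\<psi> \<in> A T) * p ^ (2 * m - e T))" if \<psi>: "\<psi> \<in> X" for \<psi>
  proof -
    define T where "T = {x \<in> V. \<phi> x = \<psi> x}"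
    have \<psi>': "\<psi> \<in> PiE (verts F) W" using \<psi> by (simp add: X_def V_def)
    have sub: "copy_edges F \<phi> \<inter> copy_edges F \<psi> \<subseteq> (\<lambda>e. \<phi> ` e) ` induced_edges F T"
      unfolding T_def V_def
      using copy_edges_Int[OF F \<phi> \<psi>' disj] .
    then have T: "T \<in> \<T>" using \<psi> by (auto simp: X_def \<T>_def T_def)
    have fin_ind: "finite (induced_edges F T)" using fin(2) by (simp add: induced_edges_def)
    have "inj_on \<phi> (verts F)" "inj_on \<psi> (verts F)"
      using partite_inj_on[OF \<phi> disj] partite_inj_on[OF \<psi>' disj] by auto
    then have "card (copy_edges F \<phi>) = m" "card (copy_edges F \<psi>) = m"
      unfolding m_def by (simp_all add: card_copy_edges[OF F])
    moreover have "card (copy_edges F \<phi> \<inter> copy_edges F \<psi>) \<le> e T"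
      unfolding e_def using surj_card_le[OF fin_ind sub] .
    moreover have "card (copy_edges F \<phi>) + card (copy_edges F \<psi>)
        = card (copy_edges F \<phi> \<union> copy_edges F \<psi>) + card (copy_edges F \<phi> \<inter> copy_edges F \<psi>)"
      using fin(2) by (intro card_Un_Int) (auto simp: copy_edges_def)
    ultimately have "2 * m - e T \<le> card (copy_edges F \<phi> \<union> copy_edges F \<psi>)" by linarith
    then have "p ^ card (copy_edges F \<phi> \<union> copy_edges F \<psi>) \<le> p ^ (2 * m - e T)"
      using p by (intro power_decreasing) auto
    also have "\<dots> = (\<Sum>T\<in>{T}. of_bool (\<psi> \<in> A T) * p ^ (2 * m - e T))"
      using \<psi> by (simp add: X_def A_def T_def)
    also have "\<dots> \<le> (\<Sum>T\<in>\<T>. of_bool (\<psi> \<in> A T) * p ^ (2 * m - e T))"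
      using T fin(1) p by (intro sum_mono2) (auto simp: \<T>_def V_def)
    finally show ?thesis .
  qed
  have term_le: "real (card (A T)) * p ^ (2 * m - e T) \<le> real r ^ card V * p ^ (2 * m) / c" if T: "T \<in> \<T>" for T
  proof -
    have TV: "T \<subseteq> V" "card T \<le> card V" using T fin(1) by (auto simp: \<T>_def V_def intro: card_mono)
    have eT: "e T \<le> 2 * m"
      using card_mono[OF fin(2), of "induced_edges F T"] by (auto simp: e_def m_def induced_edges_def)
    have "real (card (A T)) * p ^ (2 * m - e T) * c
        \<le> real r ^ (card V - card T) * p ^ (2 * m - e T) * (real r ^ card T * p ^ e T)"
      unfolding A_def e_def using card_PiE_agree[of V T \<phi> W r] TV T fin(1) W \<phi> p dense[of T]
      by (auto simp: V_def \<T>_def intro!: mult_left_mono)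
    also have "\<dots> = (real r ^ (card V - card T) * real r ^ card T) * (p ^ (2 * m - e T) * p ^ e T)"
      by (simp only: mult_ac)
    also have "\<dots> = real r ^ card V * p ^ (2 * m)"
      using TV eT by (simp add: power_add[symmetric])
    finally show ?thesis using c by (simp add: field_simps)
  qed
  have "(\<Sum>\<psi>\<in>X. p ^ card (copy_edges F \<phi> \<union> copy_edges F \<psi>))
      \<le> (\<Sum>\<psi>\<in>X. \<Sum>T\<in>\<T>. of_bool (\<psi> \<in> A T) * p ^ (2 * m - e T))"
    by (intro sum_mono bound)
  also have "\<dots> \<le> (\<Sum>\<psi>\<in>PiE V W. \<Sum>T\<in>\<T>. of_bool (\<psi> \<in> A T) * p ^ (2 * m - e T))"
    using p finPi by (intro sum_mono2 sum_nonneg) (auto simp: X_def)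
  also have "\<dots> = (\<Sum>T\<in>\<T>. \<Sum>\<psi>\<in>PiE V W. of_bool (\<psi> \<in> A T) * p ^ (2 * m - e T))"
    by (rule sum.swap)
  also have "\<dots> = (\<Sum>T\<in>\<T>. real (card (A T)) * p ^ (2 * m - e T))"
  proof (rule sum.cong[OF refl])
    fix T
    have "(\<Sum>\<psi>\<in>PiE V W. of_bool (\<psi> \<in> A T) * p ^ (2 * m - e T)) = (\<Sum>\<psi>\<in>A T. p ^ (2 * m - e T))"
      using finPi by (intro sum.mono_neutral_cong_right) (auto simp: A_def)
    then show "(\<Sum>\<psi>\<in>PiE V W. of_bool (\<psi> \<in> A T) * p ^ (2 * m - e T))
        = real (card (A T)) * p ^ (2 * m - e T)" by simp
  qed
  also have "\<dots> \<le> (\<Sum>T\<in>\<T>. real r ^ card V * p ^ (2 * m) / c)"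
    by (intro sum_mono term_le)
  also have "\<dots> = real (card \<T>) * (real r ^ card V * p ^ (2 * m) / c)" by simp
  also have "\<dots> \<le> 2 ^ card V * (real r ^ card V * p ^ (2 * m) / c)"
  proof (intro mult_right_mono)
    have "card \<T> \<le> card (Pow V)" using fin(1) by (intro card_mono) (auto simp: \<T>_def V_def)
    then show "real (card \<T>) \<le> 2 ^ card V"
      using fin(1) by (simp add: card_Pow V_def)
  qed (use p c in auto)
  finally show ?thesis by (simp add: X_def V_def m_def)
qed

section \<open>Janson's inequality for copies in many disjoint blocks\<close>

definition partite_copies :: "'a graph \<Rightarrow> 'j set \<Rightarrow> ('j \<Rightarrow> 'a \<Rightarrow> 'v set) \<Rightarrow> ('j \<times> ('a \<Rightarrow> 'v)) set" where
  "partite_copies F J W = Sigma J (\<lambda>j. PiE (verts F) (W j))"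

text \<open>As the pieces \<open>W j x\<close> are disjoint, every choice of one vertex in each piece \<open>W j x\<close>, \<open>x \<in> V(F)\<close>,
  is injective, and two copies share an edge only if they agree on both of its ends.\<close>

lemma prob_no_partite_copy:
  fixes F :: "'a graph" and W :: "'j \<Rightarrow> 'a \<Rightarrow> 'v set"
  assumes F: "simple_graph F" "edges F \<noteq> {}" and p: "0 < p" "p \<le> 1" and r: "0 < r"
    and J: "finite J" "J \<noteq> {}" and A: "finite A"
    and W: "\<And>j x. j \<in> J \<Longrightarrow> x \<in> verts F \<Longrightarrow> card (W j x) = r"
    and disj: "\<And>i j x y. i \<in> J \<Longrightarrow> j \<in> J \<Longrightarrow> x \<in> verts F \<Longrightarrow> y \<in> verts F \<Longrightarrow> (i, x) \<noteq> (j, y) \<Longrightarrow>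
      W i x \<inter> W j y = {}"
    and c: "0 < c" and dense: "\<And>T. T \<subseteq> verts F \<Longrightarrow> induced_edges F T \<noteq> {} \<Longrightarrow>
      c \<le> real r ^ card T * p ^ card (induced_edges F T)"
    and sub: "\<And>j \<phi>. (j, \<phi>) \<in> partite_copies F J W \<Longrightarrow> copy_edges F \<phi> \<subseteq> A"
  shows "bin_expect p A (avoids (\<lambda>(j, \<phi>). copy_edges F \<phi>) (partite_copies F J W))
    \<le> exp (- (real (card J) * c / 2 ^ (card (verts F) + 2)))"
proof -
  define V where "V = verts F"
  define v where "v = card V"
  define m where "m = card (edges F)"
  define I where "I = partite_copies F J W"
  define E where "E = (\<lambda>(j :: 'j, \<phi> :: 'a \<Rightarrow> 'v). copy_edges F \<phi>)"
  define P where "P = {(i, k) \<in> I \<times> I. i \<noteq> k \<and> E i \<inter> E k \<noteq> {}}"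
  define g where "g = real (card J)"
  define a where "a = real r ^ v * p ^ m"
  define b where "b = 2 ^ v * (real r ^ v * p ^ (2 * m) / c)"
  \<comment> \<open>Chosen so that the correlation bound \<open>card I * b\<close> equals
    \<open>\<kappa> * (g * a)^2\<close>, where \<open>g * a\<close> is the mean number of
    copies.\<close>
  define \<kappa> where "\<kappa> = 2 ^ v / (g * c)"
  note fin = simple_graph_finite[OF F(1)]
  have g: "0 < g" using J by (auto simp: g_def card_gt_0_iff)
  have a: "0 < a" using p r by (simp add: a_def)
  have finPi: "finite (PiE V (W j))" if "j \<in> J" for j
    using fin(1) W[OF that] r card_ge_0_finite by (auto simp: V_def intro!: finite_PiE)
  have finI: "finite I"
    unfolding I_def partite_copies_def using J finPi by (auto simp: V_def)
  have cardI: "real (card I) = g * real r ^ v"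
  proof -
    have "card I = (\<Sum>j\<in>J. card (PiE V (W j)))"
      unfolding I_def partite_copies_def V_def[symmetric] using J finPi by (intro card_SigmaI) auto
    also have "\<dots> = (\<Sum>j\<in>J. r ^ v)"
      using W fin(1) by (intro sum.cong) (auto simp: card_PiE V_def v_def)
    finally show ?thesis by (simp add: g_def)
  qed
  have disj': "W j x \<inter> W j y = {}" if "j \<in> J" "x \<in> verts F" "y \<in> verts F" "x \<noteq> y" for j x y
    using disj[of j j x y] that by auto
  have cardE: "card (E i) = m" if i: "i \<in> I" for i
  proof -
    obtain j \<phi> where j: "i = (j, \<phi>)" "j \<in> J" "\<phi> \<in> PiE (verts F) (W j)"
      using i by (auto simp: I_def partite_copies_def)
    show ?thesis
      using card_copy_edges[OF F(1) partite_inj_on[OF j(3) disj'[OF j(2)]]] by (simp add: E_def j m_def)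
  qed
  have \<mu>: "(\<Sum>i\<in>I. p ^ card (E i)) = g * a"
    using cardE cardI by (simp add: a_def)
  \<comment> \<open>Copies in different blocks share no vertex. Correlation thus grows linearly in
    the number of blocks but the squared mean quadratically, which makes the final exponent
    proportional to \<open>card J\<close>.\<close>
  have same: "j = k" if h: "(j, \<phi>) \<in> I" "(k, \<psi>) \<in> I" "E (j, \<phi>) \<inter> E (k, \<psi>) \<noteq> {}" for j k \<phi> \<psi>
  proof -
    obtain s t where st: "s \<in> edges F" "t \<in> edges F" "\<phi> ` s = \<psi> ` t"
      using h(3) by (auto simp: E_def copy_edges_def)
    have "s \<noteq> {}" using fin(3)[OF st(1)] by auto
    then obtain x y where xy: "x \<in> s" "y \<in> t" "\<phi> x = \<psi> y" using st(3) by blast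
    then have V: "x \<in> verts F" "y \<in> verts F" using fin(3) st by auto
    then have "\<phi> x \<in> W j x \<inter> W k y"
      using h xy by (auto simp: I_def partite_copies_def PiE_iff)
    then show ?thesis using disj[of j k x y] V h by (auto simp: I_def partite_copies_def)
  qed
  have inner: "(\<Sum>k\<in>{k \<in> I. i \<noteq> k \<and> E i \<inter> E k \<noteq> {}}. p ^ card (E i \<union> E k)) \<le> b" if i: "i \<in> I" for i
  proof -
    obtain j \<phi> where j: "i = (j, \<phi>)" "j \<in> J" "\<phi> \<in> PiE (verts F) (W j)"
      using i by (auto simp: I_def partite_copies_def)
    define X where "X = {\<psi> \<in> PiE (verts F) (W j). copy_edges F \<phi> \<inter> copy_edges F \<psi> \<noteq> {}}"
    have finX: "finite X" using finPi[OF j(2)] by (simp add: X_def V_def)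
    have "{k \<in> I. i \<noteq> k \<and> E i \<inter> E k \<noteq> {}} \<subseteq> Pair j ` X"
    proof
      fix k assume k: "k \<in> {k \<in> I. i \<noteq> k \<and> E i \<inter> E k \<noteq> {}}"
      obtain j' \<psi> where k': "k = (j', \<psi>)" by (cases k)
      have "j = j'" using same[of j \<phi> j' \<psi>] k k' i j by auto
      then show "k \<in> Pair j ` X"
        using k unfolding k' j(1) by (auto simp: X_def E_def I_def partite_copies_def)
    qed
    then have "(\<Sum>k\<in>{k \<in> I. i \<noteq> k \<and> E i \<inter> E k \<noteq> {}}. p ^ card (E i \<union> E k))
        \<le> (\<Sum>k\<in>Pair j ` X. p ^ card (E i \<union> E k))"
      using p finX by (intro sum_mono2) auto
    also have "\<dots> = (\<Sum>\<psi>\<in>X. p ^ card (copy_edges F \<phi> \<union> copy_edges F \<psi>))"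
      by (simp add: sum.reindex inj_on_def E_def j(1))
    also have "\<dots> \<le> b"
      unfolding X_def b_def v_def V_def m_def
      by (rule copies_correlation[OF F(1) p r W[OF j(2)] disj'[OF j(2)] c dense j(3)])
    finally show ?thesis .
  qed
  have "(\<Sum>(i, k)\<in>P. p ^ card (E i \<union> E k))
      = (\<Sum>i\<in>I. \<Sum>k\<in>{k \<in> I. i \<noteq> k \<and> E i \<inter> E k \<noteq> {}}. p ^ card (E i \<union> E k))"
  proof -
    have "P = Sigma I (\<lambda>i. {k \<in> I. i \<noteq> k \<and> E i \<inter> E k \<noteq> {}})" by (auto simp: P_def)
    then show ?thesis using finI by (simp add: sum.Sigma)
  qed
  also have "\<dots> \<le> (\<Sum>i\<in>I. b)" by (intro sum_mono inner)
  also have "\<dots> = \<kappa> * (g * a)\<^sup>2"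
    using g c by (simp add: cardI b_def \<kappa>_def a_def power2_eq_square power_mult_distrib
        power_mult[symmetric] mult.commute[of m] field_simps mult_2_right power_add)
  finally have \<Delta>: "(\<Sum>(i, k)\<in>P. p ^ card (E i \<union> E k)) \<le> \<kappa> * (g * a)\<^sup>2" .
  \<comment> \<open>Density for the whole vertex set of \<open>F\<close> gives
    \<open>c \<le> a\<close>, which supplies the condition \<open>1 \<le> 2 \<kappa> \<mu>\<close>
    of the quadratic form of Janson's inequality.\<close>
  have "induced_edges F (verts F) = edges F" using fin(3) by (auto simp: induced_edges_def)
  then have "c \<le> 1 * a" using dense[of "verts F"] F(2) by (simp add: a_def v_def V_def m_def)
  moreover have "(1 :: real) \<le> 2 ^ v" by (rule one_le_power) simp
  then have "1 * a \<le> 2 * 2 ^ v * a" using a by (intro mult_right_mono) linarith+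
  ultimately have "c \<le> 2 * 2 ^ v * a" by linarith
  then have one: "1 \<le> 2 * \<kappa> * (g * a)"
    using g c by (simp add: \<kappa>_def field_simps)
  have "bin_expect p A (avoids E I) \<le> exp (- (1 / (4 * \<kappa>)))"
  proof (rule janson_quadratic[OF A finI])
    show "E i \<subseteq> A" if "i \<in> I" for i
      using sub that by (cases i) (auto simp: E_def I_def)
    show "0 < \<kappa>" using g c by (simp add: \<kappa>_def)
  qed (use p one \<Delta> \<mu> in \<open>simp_all add: P_def\<close>)
  also have "1 / (4 * \<kappa>) = g * c / 2 ^ (v + 2)"
    using g c by (simp add: \<kappa>_def power_add field_simps)
  finally show ?thesis by (simp add: E_def I_def g_def v_def V_def)
qed

lemma ex_disjoint_pieces:
  assumes "finite V" "finite X" "card V * r \<le> card X"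
  shows "\<exists>W. (\<forall>x\<in>V. W x \<subseteq> X \<and> card (W x) = r) \<and> (\<forall>x\<in>V. \<forall>y\<in>V. x \<noteq> y \<longrightarrow> W x \<inter> W y = {})"
  using assms
proof (induction V arbitrary: X rule: finite_induct)
  case (insert a V)
  then have "r \<le> card X" by simp
  then obtain Y where Y: "Y \<subseteq> X" "card Y = r"
    using obtain_subset_with_card_n by metis
  have finY: "finite Y" using Y insert.prems(1) finite_subset by auto
  have "card V * r \<le> card (X - Y)"
    using insert Y finY by (simp add: card_Diff_subset)
  then have "\<exists>W. (\<forall>x\<in>V. W x \<subseteq> X - Y \<and> card (W x) = r)
      \<and> (\<forall>x\<in>V. \<forall>y\<in>V. x \<noteq> y \<longrightarrow> W x \<inter> W y = {})"
    using insert.prems(1) by (intro insert.IH) auto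
  then obtain W where W: "\<forall>x\<in>V. W x \<subseteq> X - Y \<and> card (W x) = r"
      "\<forall>x\<in>V. \<forall>y\<in>V. x \<noteq> y \<longrightarrow> W x \<inter> W y = {}"
    by (elim exE conjE)
  have "W x \<inter> Y = {}" if "x \<in> V" for x using W(1) that by auto
  then show ?case
    using W Y insert.hyps by (intro exI[of _ "W(a := Y)"]) auto
qed auto

subsection \<open>Copies inside blocks\<close>

text \<open>Blocks are the classes of \<open>x div m\<close>, with indices from \<open>0\<close> to
  \<open>n div m\<close>. As vertices start at \<open>1\<close>, block \<open>0\<close> has fewer
  than \<open>m\<close> elements, and the last block may be cut short.\<close>

definition block_edges :: "nat \<Rightarrow> nat \<Rightarrow> nat set set" where
  "block_edges n m = {e \<in> [{1..n}]\<^bsup>2\<^esup>. \<forall>x\<in>e. \<forall>y\<in>e. x div m = y div m}"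

lemma card_block_edges:
  assumes "0 < m"
  shows "card (block_edges n m) \<le> n * m"
proof -
  have "block_edges n m \<subseteq> (\<lambda>(x, y). {x, y}) ` Sigma {1..n} (\<lambda>x. {x div m * m..<x div m * m + m})"
  proof
    fix e assume e: "e \<in> block_edges n m"
    then obtain x y where xy: "e = {x, y}" "x \<in> {1..n}"
      by (auto simp: block_edges_def nsets_def card_2_iff)
    then have "y div m = x div m" using e unfolding block_edges_def by blast
    then have "x div m * m \<le> y" "y < x div m * m + m"
      using div_mult_mod_eq[of y m] mod_less_divisor[OF assms, of y] by auto
    then show "e \<in> (\<lambda>(x, y). {x, y}) ` Sigma {1..n} (\<lambda>x. {x div m * m..<x div m * m + m})"
      using xy by force
  qed
  then have "card (block_edges n m) \<le> card (Sigma {1..n} (\<lambda>x. {x div m * m..<x div m * m + m}))"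
    by (rule surj_card_le[rotated]) auto
  also have "\<dots> = n * m" by simp
  finally show ?thesis .
qed

text \<open>A block in \<open>J\<close> holds at most \<open>m\<close> elements of \<open>U\<close>,
  any other fewer than \<open>s\<close>.\<close>

lemma many_large_blocks:
  fixes s :: nat
  assumes "0 < m" "U \<subseteq> {1..n}"
  defines "J \<equiv> {j \<in> {..n div m}. s \<le> card {x \<in> U. x div m = j}}"
  shows "card U \<le> card J * m + (n div m + 1) * s"
proof -
  have finU: "finite U" using assms finite_subset by auto
  have block: "card {x \<in> U. x div m = j} \<le> m" for j
  proof -
    have "{x \<in> U. x div m = j} \<subseteq> {j * m..<j * m + m}"
    proof
      fix x assume "x \<in> {x \<in> U. x div m = j}"
      then show "x \<in> {j * m..<j * m + m}"
        using div_mult_mod_eq[of x m] mod_less_divisor[OF assms(1), of x] by auto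
    qed
    then show ?thesis using card_mono[of "{j * m..<j * m + m}"] by fastforce
  qed
  have "card U = (\<Sum>j\<le>n div m. card {x \<in> U. x div m = j})"
    using finU assms sum.group[of U "{..n div m}" "\<lambda>x. x div m" "\<lambda>_. 1::nat"]
    by (force simp: div_le_mono)
  also have "\<dots> \<le> (\<Sum>j\<le>n div m. (if j \<in> J then m else 0) + s)"
    using block by (intro sum_mono) (auto simp: J_def trans_le_add1)
  also have "\<dots> = card J * m + (n div m + 1) * s"
    by (simp add: sum.distrib sum.If_cases J_def Int_def)
  finally show ?thesis .
qed

definition contains_copy :: "'a graph \<Rightarrow> 'v set set \<Rightarrow> 'v set \<Rightarrow> bool" where
  "contains_copy F S U \<longleftrightarrow> (\<exists>\<phi>. inj_on \<phi> (verts F) \<and> \<phi> ` verts F \<subseteq> U \<and> copy_edges F \<phi> \<subseteq> S)"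

text \<open>By \<open>large\<close> at least \<open>g\<close> blocks contain
  \<open>card (verts F) * r\<close> vertices of \<open>U\<close>, room for one piece of size
  \<open>r\<close> per vertex of \<open>F\<close>. Copies with one vertex in each piece lie inside a
  block, so they survive the restriction to block edges.\<close>

lemma prob_no_block_copy:
  fixes F :: "'a graph" and U :: "nat set"
  assumes F: "simple_graph F" "edges F \<noteq> {}" and p: "0 < p" "p \<le> 1" and r: "0 < r"
    and m: "0 < m" and U: "U \<subseteq> {1..n}"
    and c: "0 < c" and dense: "\<And>T. T \<subseteq> verts F \<Longrightarrow> induced_edges F T \<noteq> {} \<Longrightarrow>
      c \<le> real r ^ card T * p ^ card (induced_edges F T)"
    and large: "real ((n div m + 1) * (card (verts F) * r)) + g * real m \<le> real (card U)" and g: "0 < g"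
  shows "bin_expect p ([{1..n}]\<^bsup>2\<^esup>) (\<lambda>S. of_bool (\<not> contains_copy F (S \<inter> block_edges n m) U))
    \<le> exp (- (g * c / 2 ^ (card (verts F) + 2)))"
proof -
  define V where "V = verts F"
  define B where "B = (\<lambda>j. {x \<in> U. x div m = j})"
  define J where "J = {j \<in> {..n div m}. card V * r \<le> card (B j)}"
  note fin = simple_graph_finite[OF F(1)]
  have finU: "finite U" using U finite_subset by auto
  have "card U \<le> card J * m + (n div m + 1) * (card V * r)"
    unfolding J_def B_def by (rule many_large_blocks[OF m U])
  then have "real (card U) \<le> real (card J) * real m + real ((n div m + 1) * (card V * r))"
    by (metis of_nat_add of_nat_le_iff of_nat_mult)
  then have "g * real m \<le> real (card J) * real m"
    using large unfolding V_def by linarith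
  then have gJ: "g \<le> real (card J)" using m by simp
  have "\<forall>j\<in>J. \<exists>W. (\<forall>x\<in>V. W x \<subseteq> B j \<and> card (W x) = r) \<and> (\<forall>x\<in>V. \<forall>y\<in>V. x \<noteq> y \<longrightarrow> W x \<inter> W y = {})"
    using fin(1) finU by (intro ballI ex_disjoint_pieces) (auto simp: J_def V_def B_def)
  then obtain W where W: "\<And>j. j \<in> J \<Longrightarrow> (\<forall>x\<in>V. W j x \<subseteq> B j \<and> card (W j x) = r)
      \<and> (\<forall>x\<in>V. \<forall>y\<in>V. x \<noteq> y \<longrightarrow> W j x \<inter> W j y = {})"
    by metis
  have copy: "inj_on \<phi> V \<and> \<phi> ` V \<subseteq> B j \<and> copy_edges F \<phi> \<subseteq> block_edges n m"
    if "(j, \<phi>) \<in> partite_copies F J W" for j \<phi>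
  proof -
    have j: "j \<in> J" and \<phi>: "\<phi> \<in> PiE V (W j)"
      using that by (auto simp: partite_copies_def V_def)
    have inj: "inj_on \<phi> V" using W[OF j] by (intro partite_inj_on[OF \<phi>]) auto
    have im: "\<phi> ` V \<subseteq> B j" using W[OF j] \<phi> by (fastforce simp: PiE_iff)
    have "\<phi> ` e \<in> block_edges n m" if "e \<in> edges F" for e
    proof -
      have e: "e \<subseteq> V" "card e = 2" using fin(3)[OF that] by (auto simp: V_def)
      then have "card (\<phi> ` e) = 2" using inj by (metis card_image inj_on_subset)
      moreover have "\<phi> ` e \<subseteq> B j" using e im by blast
      ultimately show ?thesis
        using U by (auto simp: block_edges_def nsets_def B_def intro: card_ge_0_finite)
    qed
    then show ?thesis using inj im by (auto simp: copy_edges_def)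
  qed
  have "of_bool (\<not> contains_copy F (S \<inter> block_edges n m) U)
      \<le> avoids (\<lambda>(j, \<phi>). copy_edges F \<phi>) (partite_copies F J W) S" for S
  proof -
    have "contains_copy F (S \<inter> block_edges n m) U"
      if "(j, \<phi>) \<in> partite_copies F J W" "copy_edges F \<phi> \<subseteq> S" for j \<phi>
      using copy[OF that(1)] that(2) unfolding contains_copy_def V_def B_def by blast
    then show ?thesis by (auto simp: avoids_def)
  qed
  then have "bin_expect p ([{1..n}]\<^bsup>2\<^esup>) (\<lambda>S. of_bool (\<not> contains_copy F (S \<inter> block_edges n m) U))
      \<le> bin_expect p ([{1..n}]\<^bsup>2\<^esup>) (avoids (\<lambda>(j, \<phi>). copy_edges F \<phi>) (partite_copies F J W))"
    using p by (intro bin_expect_mono) auto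
  also have "\<dots> \<le> exp (- (real (card J) * c / 2 ^ (card (verts F) + 2)))"
  proof (rule prob_no_partite_copy[OF F p r _ _ _ _ _ c dense])
    show "finite J" by (simp add: J_def)
    show "J \<noteq> {}" using gJ g by auto
    show "finite ([{1..n}]\<^bsup>2\<^esup>)" by (simp add: finite_imp_finite_nsets)
    show "card (W j x) = r" if "j \<in> J" "x \<in> verts F" for j x using W that by (simp add: V_def)
    show "W i x \<inter> W j y = {}"
      if "i \<in> J" "j \<in> J" "x \<in> verts F" "y \<in> verts F" "(i, x) \<noteq> (j, y)" for i j x y
    proof (cases "i = j")
      case True
      then show ?thesis using W[OF that(1)] that by (auto simp: V_def)
    next
      case False
      then have "B i \<inter> B j = {}" by (auto simp: B_def)
      moreover have "W i x \<subseteq> B i" "W j y \<subseteq> B j"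
        using W[OF that(1)] W[OF that(2)] that(3,4) by (auto simp: V_def)
      ultimately show ?thesis by blast
    qed
    show "copy_edges F \<phi> \<subseteq> [{1..n}]\<^bsup>2\<^esup>" if "(j, \<phi>) \<in> partite_copies F J W" for j \<phi>
      using copy[OF that] by (auto simp: block_edges_def)
  qed
  also have "\<dots> \<le> exp (- (g * c / 2 ^ (card (verts F) + 2)))"
    using gJ c by (simp add: divide_right_mono mult_right_mono)
  finally show ?thesis .
qed

section \<open>From the maximum density to the constants\<close>

lemma induced_edges_density:
  assumes F: "simple_graph F" and T: "T \<subseteq> verts F" "2 \<le> card T"
  shows "real (card (induced_edges F T)) \<le> max_density F * (real (card T) - 1)"
proof -
  have "finite T" using T simple_graph_finite(1)[OF F] finite_subset by auto
  then have "subgraph (T, induced_edges F T) F"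
    using T simple_graph_finite(3)[OF F]
    by (auto simp: subgraph_def simple_graph_def induced_edges_def nsets_def finite_subset)
  then have "density (T, induced_edges F T) \<le> max_density F"
    unfolding max_density_def using T by (intro Max_ge finite_imageI finite_subgraphs[OF F]) auto
  then show ?thesis using T by (simp add: density_def field_simps)
qed

text \<open>A single edge already has density \<open>1\<close>.\<close>

lemma max_density_ge_1:
  assumes "simple_graph F" "edges F \<noteq> {}"
  shows "1 \<le> max_density F"
proof -
  obtain e where "e \<in> edges F" using assms by auto
  moreover from this have e: "e \<subseteq> verts F" "card e = 2" using simple_graph_finite(3)[OF assms(1)] by auto
  ultimately have "induced_edges F e \<noteq> {}" by (auto simp: induced_edges_def)
  then have "0 < card (induced_edges F e)"
    using simple_graph_finite(2)[OF assms(1)] by (simp add: card_gt_0_iff induced_edges_def)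
  then show ?thesis using induced_edges_density[OF assms(1) e(1)] e(2) by simp
qed

text \<open>With \<open>k + 1\<close> vertices there are at most \<open>d k\<close> edges,
  \<open>d\<close> being the maximum density, so \<open>r ^ k\<close> times the edge factor is at
  least \<open>(r p^d) ^ k \<ge> c ^ k \<ge> c\<close>. The one vertex left over by the denominator
  \<open>v - 1\<close> of the density supplies the extra factor \<open>r\<close>.\<close>

lemma expected_induced_copies:
  assumes F: "simple_graph F" and p: "0 < p" "p \<le> 1"
    and c: "1 \<le> c" "c \<le> real r * p powr max_density F"
    and T: "T \<subseteq> verts F" "induced_edges F T \<noteq> {}"
  shows "real r * c \<le> real r ^ card T * p ^ card (induced_edges F T)"
proof -
  obtain e where e: "e \<in> edges F" "e \<subseteq> T" using T(2) by (auto simp: induced_edges_def)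
  have "finite T" using T(1) simple_graph_finite(1)[OF F] finite_subset by auto
  then have T2: "2 \<le> card T"
    using e simple_graph_finite(3)[OF F] card_mono by metis
  then obtain k where k: "card T = Suc k" "1 \<le> k" by (cases "card T") auto
  have "c ^ 1 \<le> c ^ k" using c k by (intro power_increasing) auto
  also have "\<dots> \<le> (real r * p powr max_density F) ^ k"
    using c by (intro power_mono) auto
  also have "\<dots> = real r ^ k * p powr (max_density F * real k)"
    using p by (simp add: power_mult_distrib powr_realpow[symmetric] powr_powr)
  also have "\<dots> \<le> real r ^ k * p powr real (card (induced_edges F T))"
    using induced_edges_density[OF F T(1) T2] p k by (intro mult_left_mono powr_mono') auto
  also have "\<dots> = real r ^ k * p ^ card (induced_edges F T)"
    using p by (simp add: powr_realpow)
  finally have "real r * c \<le> real r * (real r ^ k * p ^ card (induced_edges F T))"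
    by (intro mult_left_mono) auto
  then show ?thesis by (simp add: k)
qed

lemma edge_orders_missing_copy:
  fixes F :: "'a graph" and \<beta> :: real
  assumes F: "simple_graph F" "edges F \<noteq> {}" and \<beta>: "0 < \<beta>" "\<beta> \<le> 1"
    and m: "0 < m" "m \<le> n" and t: "0 < t" "t \<le> n choose 2"
    and C: "2 ^ (card (verts F) + 10) * (real (card (verts F)))\<^sup>2 / \<beta> ^ 3
      \<le> real m * (real t / (real n)\<^sup>2) powr max_density F"
  shows "real (card {es \<in> edge_orders n. \<exists>U\<subseteq>{1..n}. \<beta> * real n \<le> real (card U) \<and>
        \<not> contains_copy F (set (take t es) \<inter> block_edges n m) U})
    \<le> fact (n choose 2) * (2 * (2 ^ n * exp (- 2 * real n)))"
proof -
  define A where "A = [{1..n}]\<^bsup>2\<^esup>"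
  define N where "N = card A"
  define p where "p = real t / (2 * real N)"
  define v where "v = card (verts F)"
  define d where "d = max_density F"
  \<comment> \<open>With pieces of size at most \<open>y\<close>, a block counts as small if it has
    fewer than \<open>\<beta> m / 4\<close> vertices of \<open>U\<close>. At most
    \<open>2 n / m\<close> blocks exist, so small ones hold at most \<open>\<beta> n / 2\<close> of
    \<open>U\<close>; the remaining half needs \<open>g\<close> blocks of size at most
    \<open>m\<close>.\<close>
  define y where "y = \<beta> * real m / (4 * real v)"
  define r where "r = nat \<lfloor>y\<rfloor>"
  \<comment> \<open>The solution of \<open>g * (y / 2 * c) / 2 ^ (v + 2) = 2 n\<close>, so that the
    exponent reaches \<open>2 n\<close> even if rounding halves \<open>y\<close>.\<close>
  define c where "c = 2 ^ (v + 7) * real v / \<beta>\<^sup>2"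
  define g where "g = \<beta> * real n / (2 * real m)"
  define \<U> where "\<U> = {U \<in> Pow {1..n}. \<beta> * real n \<le> real (card U)}"
  let ?Q = "\<lambda>U S. \<not> contains_copy F (S \<inter> block_edges n m) U"
  have finA: "finite A" by (simp add: A_def finite_imp_finite_nsets)
  have N: "N = n choose 2" by (simp add: N_def A_def card_nsets)
  have d1: "1 \<le> d" using max_density_ge_1[OF F] by (simp add: d_def)
  have "0 < v"
    using F simple_graph_finite(1)[OF F(1)] simple_graph_finite(3)[OF F(1)]
    by (fastforce simp: v_def card_gt_0_iff)
  then have v: "1 \<le> v" by simp
  have n: "0 < n" using m by simp
  have Npos: "0 < N" using t N by linarith
  have p: "0 < p" "p \<le> 1" using t Npos N by (auto simp: p_def field_simps)
  \<comment> \<open>The factor \<open>1 / 2\<close> in the density \<open>p\<close> is offset by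
    \<open>2 N \<le> n^2\<close>, so \<open>p\<close> is still at least
    \<open>t / n^2\<close>.\<close>
  have "2 * N \<le> n * (n - 1)" unfolding N choose_two by simp
  also have "\<dots> \<le> n * n" by (intro mult_le_mono) auto
  finally have "2 * real N \<le> (real n)\<^sup>2"
    unfolding power2_eq_square by (metis of_nat_le_iff of_nat_mult of_nat_numeral)
  then have pt: "real t / (real n)\<^sup>2 \<le> p"
    using t Npos n unfolding p_def by (intro divide_left_mono) auto
  \<comment> \<open>As \<open>r\<close> will be at least \<open>\<beta> m / (8 v)\<close>, this is
    exactly what gives \<open>c \<le> r p^d\<close>.\<close>
  have C': "8 * real v * c / \<beta> \<le> real m * p powr d"
  proof -
    have "8 * real v * c / \<beta> = 2 ^ (v + 10) * (real v)\<^sup>2 / \<beta> ^ 3"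
      using \<beta> by (simp add: c_def power2_eq_square power3_eq_cube power_add field_simps)
    also have "\<dots> \<le> real m * (real t / (real n)\<^sup>2) powr d" using C by (simp add: v_def d_def)
    also have "\<dots> \<le> real m * p powr d"
      using pt d1 by (intro mult_left_mono powr_mono2) auto
    finally show ?thesis .
  qed
  have c1: "1 \<le> c"
  proof -
    have "\<beta>\<^sup>2 \<le> 1" using \<beta> by (simp add: power_le_one)
    moreover have "1 * 1 \<le> 2 ^ (v + 7) * real v"
      using v by (intro mult_mono one_le_power) auto
    ultimately have "\<beta>\<^sup>2 \<le> 2 ^ (v + 7) * real v" by linarith
    then show ?thesis using \<beta> by (simp add: c_def field_simps)
  qed
  have "8 * real v * c / \<beta> \<le> real m * 1"
  proof -
    have "p powr d \<le> 1 powr d" using p d1 by (intro powr_mono2) auto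
    then have "real m * p powr d \<le> real m * 1" by (intro mult_left_mono) auto
    with C' show ?thesis by linarith
  qed
  \<comment> \<open>Hence \<open>y \<ge> 2\<close>, and rounding down to \<open>r\<close> keeps at
    least half of \<open>y\<close>.\<close>
  then have "2 * c \<le> y" using v \<beta> by (simp add: y_def field_simps)
  then have y: "2 \<le> y" using c1 by linarith
  have r: "real r \<le> y" "y / 2 \<le> real r" "0 < r"
    using y by (auto simp: r_def) linarith+
  have rc: "c \<le> real r * p powr d"
  proof -
    have "c = \<beta> / (8 * real v) * (8 * real v * c / \<beta>)" using v \<beta> by simp
    also have "\<dots> \<le> \<beta> / (8 * real v) * (real m * p powr d)"
      using C' \<beta> v by (intro mult_left_mono) auto
    also have "\<dots> = y / 2 * p powr d" by (simp add: y_def)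
    also have "\<dots> \<le> real r * p powr d" using r by (intro mult_right_mono) auto
    finally show ?thesis .
  qed
  have expo: "2 * real n \<le> g * (real r * c) / 2 ^ (v + 2)"
  proof -
    have "2 * real n = g * (y / 2 * c) / 2 ^ (v + 2)"
      using v \<beta> m by (simp add: g_def y_def c_def power2_eq_square power_add field_simps)
    also have "\<dots> \<le> g * (real r * c) / 2 ^ (v + 2)"
      using r c1 \<beta> by (intro divide_right_mono mult_left_mono mult_right_mono) (auto simp: g_def)
    finally show ?thesis .
  qed
  have large: "real ((n div m + 1) * (v * r)) + g * real m \<le> \<beta> * real n"
  proof -
    have "real (n div m) \<le> real n / real m" by (simp add: of_nat_div_le_of_nat)
    moreover have "1 \<le> real n / real m" using m by simp
    ultimately have "real (n div m + 1) \<le> 2 * (real n / real m)" by simp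
    moreover have "real (v * r) \<le> \<beta> * real m / 4"
      using r(1) v by (simp add: y_def field_simps)
    ultimately have "real (n div m + 1) * real (v * r) \<le> (2 * (real n / real m)) * (\<beta> * real m / 4)"
      by (intro mult_mono) auto
    also have "\<dots> = \<beta> * real n - g * real m" using m by (simp add: g_def field_simps)
    finally show ?thesis unfolding of_nat_mult[of "n div m + 1"] by linarith
  qed
  have missing: "real (card {es \<in> permutations_of_set A. ?Q U (set (take t es))})
      \<le> 2 * fact N * exp (- 2 * real n)" if U: "U \<in> \<U>" for U
  proof -
    have "real (card {es \<in> permutations_of_set A. ?Q U (set (take t es))})
        \<le> 2 * fact N * bin_expect p A (\<lambda>S. of_bool (?Q U S))"
      unfolding N_def p_def
    proof (rule card_permutations_take_le_bin_expect[OF finA])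
      show "?Q U S" if "S \<subseteq> T" "?Q U T" for S T :: "nat set set"
        using that by (force simp: contains_copy_def)
    qed (use t N in \<open>simp_all add: N_def\<close>)
    also have "bin_expect p A (\<lambda>S. of_bool (?Q U S)) \<le> exp (- (g * (real r * c) / 2 ^ (v + 2)))"
      unfolding A_def v_def
    proof (rule prob_no_block_copy[OF F p r(3) m(1)])
      show "real r * c \<le> real r ^ card T * p ^ card (induced_edges F T)"
        if "T \<subseteq> verts F" "induced_edges F T \<noteq> {}" for T
        using expected_induced_copies[OF F(1) p c1 rc[unfolded d_def] that] .
    qed (use U large r c1 \<beta> m n in \<open>auto simp: \<U>_def v_def g_def\<close>)
    also have "\<dots> \<le> exp (- 2 * real n)" using expo by simp
    finally show ?thesis by simp
  qed
  have "{es \<in> edge_orders n. \<exists>U\<subseteq>{1..n}. \<beta> * real n \<le> real (card U) \<and>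
        \<not> contains_copy F (set (take t es) \<inter> block_edges n m) U}
      = (\<Union>U\<in>\<U>. {es \<in> permutations_of_set A. ?Q U (set (take t es))})" (is "?L = ?R")
    by (auto simp: \<U>_def A_def edge_orders_def)
  then have "real (card ?L) \<le> real (\<Sum>U\<in>\<U>. card {es \<in> permutations_of_set A. ?Q U (set (take t es))})"
    by (simp only: of_nat_le_iff) (intro card_UN_le, simp add: \<U>_def)
  also have "\<dots> \<le> (\<Sum>U\<in>\<U>. 2 * fact N * exp (- 2 * real n))"
    unfolding of_nat_sum by (intro sum_mono missing)
  also have "\<dots> = real (card \<U>) * (2 * fact N * exp (- 2 * real n))" by simp
  also have "\<dots> \<le> 2 ^ n * (2 * fact N * exp (- 2 * real n))"
  proof (intro mult_right_mono)
    have "card \<U> \<le> card (Pow {1..n})" by (intro card_mono) (auto simp: \<U>_def)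
    then show "real (card \<U>) \<le> 2 ^ n" by (simp add: card_Pow)
  qed auto
  finally show ?thesis by (simp add: N mult_ac)
qed

subsection \<open>The block strategy\<close>

text \<open>Greedy choice: until enough copies are found, they cover fewer than
  \<open>\<alpha> n\<close> vertices, and the uncovered set contains another copy.\<close>

lemma has_factor_if_contains_copies:
  fixes F :: "'a graph" and n :: nat
  assumes F: "simple_graph F" "edges F \<noteq> {}" and S: "S \<subseteq> [{1..n}]\<^bsup>2\<^esup>"
    and copies: "\<And>U. U \<subseteq> {1..n} \<Longrightarrow> (1 - \<alpha>) * real n \<le> real (card U) \<Longrightarrow> contains_copy F S U"
  shows "has_factor \<alpha> F ({1..n}, S)"
proof -
  define v where "v = card (verts F)"
  define k where "k = nat \<lceil>\<alpha> * real n / real v\<rceil>"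
  note fin = simple_graph_finite[OF F(1)]
  have "verts F \<noteq> {}" using F(2) fin(3) by fastforce
  then have v: "0 < v" using fin(1) by (simp add: v_def card_gt_0_iff)
  have "\<exists>C. finite C \<and> card C = i \<and> (\<forall>H\<in>C. subgraph H ({1..n}, S) \<and> graph_iso F H)
      \<and> disjoint_family_on verts C" if "i \<le> k" for i
    using that
  proof (induction i)
    case 0
    show ?case by (intro exI[of _ "{}"]) (auto simp: disjoint_family_on_def)
  next
    case (Suc i)
    then obtain C where C: "finite C" "card C = i"
        "\<And>H. H \<in> C \<Longrightarrow> subgraph H ({1..n}, S) \<and> graph_iso F H" "disjoint_family_on verts C"
      by auto
    define U where "U = {1..n} - \<Union> (verts ` C)"
    have cardH: "card (verts H) = v" if "H \<in> C" for H
      using C(3)[OF that] by (auto simp: graph_iso_def v_def dest: bij_betw_same_card)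
    have "card (\<Union> (verts ` C)) \<le> (\<Sum>H\<in>C. card (verts H))" by (rule card_UN_le[OF C(1)])
    also have "\<dots> = i * v" using cardH C(2) by simp
    finally have "real (card (\<Union> (verts ` C))) \<le> real i * real v"
      by (metis of_nat_le_iff of_nat_mult)
    \<comment> \<open>\<open>Suc i \<le> k\<close> and \<open>k\<close> is a ceiling, so
      \<open>i\<close> is strictly below the unrounded target.\<close>
    moreover have "real i < \<alpha> * real n / real v" using Suc.prems by (simp add: k_def) linarith
    then have "real i * real v < \<alpha> * real n" using v by (simp add: field_simps)
    moreover have "n \<le> card U + card (\<Union> (verts ` C))"
    proof -
      have "\<Union> (verts ` C) \<subseteq> {1..n}" using C(3) by (auto simp: subgraph_def)
      then have "finite (U \<union> \<Union> (verts ` C))" by (auto simp: U_def intro: finite_subset)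
      then have "card {1..n} \<le> card (U \<union> \<Union> (verts ` C))"
        by (rule card_mono) (auto simp: U_def)
      also have "\<dots> \<le> card U + card (\<Union> (verts ` C))" by (rule card_Un_le)
      finally show ?thesis by simp
    qed
    ultimately have "(1 - \<alpha>) * real n \<le> real (card U)" by (simp add: algebra_simps)
    then have "contains_copy F S U" by (intro copies) (auto simp: U_def)
    then obtain \<phi> where \<phi>: "inj_on \<phi> (verts F)" "\<phi> ` verts F \<subseteq> U" "copy_edges F \<phi> \<subseteq> S"
      by (auto simp: contains_copy_def)
    define H where "H = (\<phi> ` verts F, copy_edges F \<phi>)"
    have "\<phi> ` e \<in> [\<phi> ` verts F]\<^bsup>2\<^esup>" if "e \<in> edges F" for e
      using fin(1) fin(3)[OF that] \<phi>(1)
      by (auto simp: nsets_def card_image inj_on_subset finite_subset)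
    then have "subgraph H ({1..n}, S)"
      using fin(1) \<phi> by (auto simp: H_def subgraph_def simple_graph_def copy_edges_def U_def)
    moreover have "graph_iso F H"
      using \<phi>(1) unfolding graph_iso_def H_def
      by (intro exI[of _ \<phi>]) (auto simp: copy_edges_def bij_betw_def)
    moreover have disj: "verts H \<inter> verts H' = {}" if "H' \<in> C" for H'
      using \<phi>(2) that by (auto simp: H_def U_def)
    \<comment> \<open>A new copy is disjoint from all old ones and has a vertex, so the family
      really grows.\<close>
    moreover have "H \<notin> C"
      using disj[of H] \<open>verts F \<noteq> {}\<close> by (auto simp: H_def)
    ultimately show ?case
      using C by (intro exI[of _ "insert H C"]) (auto simp: disjoint_family_on_def)
  qed
  then obtain C where C: "finite C" "card C = k"
      "\<forall>H\<in>C. subgraph H ({1..n}, S) \<and> graph_iso F H" "disjoint_family_on verts C"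
    by blast
  have "\<alpha> * real n / real v \<le> real k" unfolding k_def by linarith
  then show ?thesis
    unfolding has_factor_def using C by (intro exI[of _ C]) (auto simp: v_def)
qed

text \<open>\<open>last es\<close> is the edge on offer, and the counter includes it. The counter
  runs over block edges presented, not bought, which comes to the same: it never decreases, so while
  it is at most \<open>b\<close> every block edge has been bought, and afterwards none is.\<close>

definition block_rule :: "nat \<Rightarrow> nat \<Rightarrow> real \<Rightarrow> rule" where
  "block_rule n m b es \<longleftrightarrow> last es \<in> block_edges n m \<and> real (card (set es \<inter> block_edges n m)) \<le> b"

text \<open>At the last purchase the counter is at most \<open>b\<close>, and everything ever bought
  is among the block edges presented by then. No randomness is involved, so the budget holds
  surely.\<close>

lemma purchased_block_rule_le:
  assumes "0 \<le> b"
  shows "real (card (purchased (block_rule n m b) es)) \<le> b"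
proof -
  define I where "I = {i. i < length es \<and> block_rule n m b (take (Suc i) es)}"
  have last: "last (take (Suc i) es) = es ! i" if "i < length es" for i
    using that by (simp add: take_Suc_conv_app_nth)
  have eq: "purchased (block_rule n m b) es = (!) es ` I"
    by (auto simp: purchased_def I_def)
  show ?thesis
  proof (cases "I = {}")
    case False
    have finI: "finite I" by (simp add: I_def)
    define k where "k = Max I"
    have k: "k \<in> I" "\<And>i. i \<in> I \<Longrightarrow> i \<le> k" using finI False by (auto simp: k_def)
    have "(!) es ` I \<subseteq> set (take (Suc k) es) \<inter> block_edges n m"
    proof
      fix e assume "e \<in> (!) es ` I"
      then obtain i where i: "i \<in> I" "e = es ! i" by auto
      have "e \<in> block_edges n m" using i last by (auto simp: I_def block_rule_def)
      moreover have "e = take (Suc k) es ! i" "i < length (take (Suc k) es)"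
        using i k(2)[OF i(1)] by (auto simp: I_def)
      then have "e \<in> set (take (Suc k) es)" by (metis nth_mem)
      ultimately show "e \<in> set (take (Suc k) es) \<inter> block_edges n m" by simp
    qed
    then have "card ((!) es ` I) \<le> card (set (take (Suc k) es) \<inter> block_edges n m)"
      by (intro card_mono) auto
    then show ?thesis using k(1) by (simp add: eq I_def block_rule_def)
  qed (use assms eq in simp)
qed

lemma purchased_block_rule_eq:
  assumes "real (card (set es \<inter> block_edges n m)) \<le> b"
  shows "purchased (block_rule n m b) es = set es \<inter> block_edges n m"
proof -
  have rule: "block_rule n m b (take (Suc i) es) \<longleftrightarrow> es ! i \<in> block_edges n m" if "i < length es" for i
  proof -
    have "card (set (take (Suc i) es) \<inter> block_edges n m) \<le> card (set es \<inter> block_edges n m)"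
      using set_take_subset[of "Suc i" es] by (intro card_mono) auto
    then show ?thesis
      using that assms by (simp add: block_rule_def take_Suc_conv_app_nth)
  qed
  have "purchased (block_rule n m b) es = {es ! i | i. i < length es \<and> es ! i \<in> block_edges n m}"
    by (simp add: purchased_def rule cong: conj_cong)
  then show ?thesis by (auto simp: in_set_conv_nth)
qed

section \<open>Success probability and choice of parameters\<close>

lemma real_choose_two: "real (n choose 2) = real n * (real n - 1) / 2"
  unfolding choose_two by (cases n) (simp_all add: real_of_nat_div algebra_simps)

text \<open>Only two events can spoil success: some large vertex set without a copy
  (\<open>Y\<close>), or more block edges than the budget allows (\<open>Z\<close>). They account
  for the two error terms.\<close>

lemma success_prob_block_rule:
  fixes F :: "'a graph"
  assumes F: "simple_graph F" "edges F \<noteq> {}" and \<alpha>: "0 < \<alpha>" "\<alpha> < 1"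
    and m: "0 < m" "m \<le> n" and t: "0 < t" "t \<le> n choose 2"
    and C: "2 ^ (card (verts F) + 10) * (real (card (verts F)))\<^sup>2 / (1 - \<alpha>) ^ 3
      \<le> real m * (real t / (real n)\<^sup>2) powr max_density F"
    and b: "16 * (real t * real m / real n) \<le> b" "real n \<le> b"
  shows "1 - (2 * (2 ^ n * exp (- 2 * real n)) + 2 powr (- (real n / 2)))
    \<le> success_prob n t (return_pmf (block_rule n m b)) (has_factor \<alpha> F)"
proof -
  define A where "A = [{1..n}]\<^bsup>2\<^esup>"
  define N where "N = n choose 2"
  define \<beta> where "\<beta> = 1 - \<alpha>"
  define X where "X = {es \<in> edge_orders n. has_factor \<alpha> F (builder_graph n t (block_rule n m b) es)}"
  define Y where "Y = {es \<in> edge_orders n. \<exists>U\<subseteq>{1..n}. \<beta> * real n \<le> real (card U) \<and>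
        \<not> contains_copy F (set (take t es) \<inter> block_edges n m) U}"
  define Z where "Z = {es \<in> edge_orders n. b < real (card (set (take t es) \<inter> block_edges n m))}"
  have finA: "finite A" "card A = N" by (simp_all add: A_def N_def finite_imp_finite_nsets)
  have orders: "finite (edge_orders n)" "edge_orders n \<noteq> {}" "card (edge_orders n) = fact N"
    using finA unfolding edge_orders_def A_def[symmetric] by simp_all
  have "has_factor \<alpha> F (builder_graph n t (block_rule n m b) es)"
    if es: "es \<in> edge_orders n" "es \<notin> Y" "es \<notin> Z" for es
  proof -
    have "purchased (block_rule n m b) (take t es) = set (take t es) \<inter> block_edges n m"
      using es by (intro purchased_block_rule_eq) (auto simp: Z_def)
    moreover have "has_factor \<alpha> F ({1..n}, set (take t es) \<inter> block_edges n m)"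
      using es by (intro has_factor_if_contains_copies F) (auto simp: Y_def \<beta>_def block_edges_def)
    ultimately show ?thesis by (simp add: builder_graph_def)
  qed
  then have "edge_orders n \<subseteq> X \<union> (Y \<union> Z)" by (auto simp: X_def)
  then have "card (edge_orders n) \<le> card (X \<union> (Y \<union> Z))"
    using orders by (intro card_mono) (auto simp: X_def Y_def Z_def)
  also have "\<dots> \<le> card X + (card Y + card Z)"
    using card_Un_le[of X "Y \<union> Z"] card_Un_le[of Y Z] by linarith
  finally have "fact N \<le> real (card X) + (real (card Y) + real (card Z))"
    unfolding orders(3) by (metis of_nat_add of_nat_fact of_nat_le_iff)
  moreover have "real (card Y) \<le> fact N * (2 * (2 ^ n * exp (- 2 * real n)))"
    unfolding Y_def N_def using \<alpha> C by (intro edge_orders_missing_copy F m t) (auto simp: \<beta>_def)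
  moreover have "real (card Z) \<le> fact N * 2 powr (- (real n / 2))"
  proof -
    \<comment> \<open>The mean number of block edges among the first \<open>t\<close>. It is at most
      \<open>4 t m / n\<close>, so the constant \<open>16\<close> leaves it below
      \<open>b / 4\<close>.\<close>
    define e where "e = real t * real (card (block_edges n m)) / real N"
    have n2: "2 \<le> n"
    proof (rule ccontr)
      assume "\<not> 2 \<le> n"
      then have "n choose 2 = 0" by (simp add: binomial_eq_0)
      then show False using t by linarith
    qed
    then have "real n \<le> 2 * (real n - 1)" by simp
    then have "real n * real n \<le> real n * (2 * (real n - 1))" by (intro mult_left_mono) auto
    also have "\<dots> = 4 * real N"
      unfolding N_def real_choose_two by simp
    finally have N: "real n * real n \<le> 4 * real N" .
    have "e \<le> real t * (real n * real m) / (real n * real n / 4)"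
      unfolding e_def using N n2 card_block_edges[OF m(1), of n]
      by (intro frac_le mult_left_mono) (auto simp flip: of_nat_mult)
    also have "\<dots> = 4 * (real t * real m / real n)" using n2 by simp
    also have "\<dots> \<le> b / 4" using b(1) by simp
    finally have "e \<le> b / 4" .
    have "real (card Z) \<le> fact (card A) * (2 powr (- b) * exp (real t * real (card (block_edges n m)) / real (card A)))"
      unfolding Z_def edge_orders_def A_def[symmetric]
      using t(2) finA by (intro card_permutations_take_Int_gt) (auto simp: N_def A_def block_edges_def)
    also have "\<dots> = fact N * (2 powr (- b) * exp e)" by (simp add: finA e_def)
    also have "\<dots> \<le> fact N * (2 powr (- b) * 2 powr (b / 2))"
    proof (intro mult_left_mono)
      \<comment> \<open>As \<open>ln 2 \<ge> 1 / 2\<close>, the exponential factor costs at most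
        half of the gain \<open>2 powr (- b)\<close>.\<close>
      have "exp e \<le> exp (b / 4)" using \<open>e \<le> b / 4\<close> by simp
      also have "\<dots> \<le> 2 powr (b / 2)"
        using ln2_ge_two_thirds b(2) mult_right_mono[of "1 / 2" "ln 2" "b / 2"] by (simp add: powr_def mult.commute)
      finally show "exp e \<le> 2 powr (b / 2)" .
    qed auto
    also have "\<dots> = fact N * 2 powr (- (b / 2))"
      by (simp flip: powr_add)
    also have "\<dots> \<le> fact N * 2 powr (- (real n / 2))"
      using b(2) by (intro mult_left_mono powr_mono) auto
    finally show ?thesis .
  qed
  ultimately have "fact N * (1 - (2 * (2 ^ n * exp (- 2 * real n)) + 2 powr (- (real n / 2)))) \<le> real (card X)"
    by (simp only: right_diff_distrib distrib_left)
  then have "1 - (2 * (2 ^ n * exp (- 2 * real n)) + 2 powr (- (real n / 2))) \<le> real (card X) / fact N"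
    by (simp add: pos_le_divide_eq mult.commute)
  also have "real (card X) / fact N = measure_pmf.prob (random_edge_order n)
      {es. has_factor \<alpha> F (builder_graph n t (block_rule n m b) es)}"
    unfolding random_edge_order_def using orders
    by (subst measure_pmf_of_set) (auto simp: X_def Int_def)
  also have "\<dots> = success_prob n t (return_pmf (block_rule n m b)) (has_factor \<alpha> F)"
    unfolding success_prob_def by (simp add: pair_return_pmf1 vimage_def)
  finally show ?thesis .
qed

theorem theorem5p6:
  fixes F :: "'a graph" and \<alpha> :: real
  assumes "simple_graph F" and "edges F \<noteq> {}"
    and "0 < \<alpha>" and "\<alpha> < 1"
  shows "\<forall>\<delta>::real. \<delta> > 0 \<longrightarrow> (\<exists>K\<^sub>1 K\<^sub>2 :: real. K\<^sub>1 > 0 \<and> K\<^sub>2 > 0 \<and>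
    (\<forall>t :: nat \<Rightarrow> nat.
      (\<forall>\<^sub>F n in sequentially.
         K\<^sub>1 * real n powr (2 - 1 / max_density F) \<le> real (t n) \<and>
         real (t n) \<le> real n powr (2 - \<delta>)) \<longrightarrow>
      (\<exists>S :: nat \<Rightarrow> strategy.
         successful_strategy t
           (\<lambda>n. K\<^sub>2 * real (t n) powr (1 - max_density F) * real n powr (2 * max_density F - 1))
           S (has_factor \<alpha> F))))"
proof (intro allI impI)
  fix \<delta> :: real assume \<delta>: "\<delta> > 0"
  define v where "v = card (verts F)"
  define d where "d = max_density F"
  define C where "C = max 1 (2 ^ (v + 10) * (real v)\<^sup>2 / (1 - \<alpha>) ^ 3)"
  \<comment> \<open>\<open>K\<^sub>1\<close> leaves room for \<open>C * x n \<le> n / 2\<close>, so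
    that a rounded-up block size still fits into \<open>n\<close>. In \<open>K\<^sub>2\<close>,
    \<open>16\<close> is the margin for the tail bound and \<open>C + 1\<close> absorbs the rounding
    of the block size.\<close>
  define K\<^sub>1 where "K\<^sub>1 = 2 * C"
  define K\<^sub>2 where "K\<^sub>2 = 16 * (C + 1)"
  have d: "1 \<le> d" using max_density_ge_1[OF assms(1,2)] by (simp add: d_def)
  have C: "1 \<le> C" by (simp add: C_def)
  have "\<exists>S :: nat \<Rightarrow> strategy. successful_strategy t
      (\<lambda>n. K\<^sub>2 * real (t n) powr (1 - d) * real n powr (2 * d - 1)) S (has_factor \<alpha> F)"
    if t: "\<forall>\<^sub>F n in sequentially.
      K\<^sub>1 * real n powr (2 - 1 / d) \<le> real (t n) \<and> real (t n) \<le> real n powr (2 - \<delta>)"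
    for t :: "nat \<Rightarrow> nat"
  proof -
    \<comment> \<open>The block size up to a constant; \<open>x n * t n / n\<close> is the budget
      without \<open>K\<^sub>2\<close>.\<close>
    define x where "x = (\<lambda>n. ((real n)\<^sup>2 / real (t n)) powr d)"
    define m where "m = (\<lambda>n. nat \<lceil>C * x n\<rceil>)"
    define b where "b = (\<lambda>n. K\<^sub>2 * real (t n) powr (1 - d) * real n powr (2 * d - 1))"
    define S where "S = (\<lambda>n. return_pmf (block_rule n (m n) (b n)))"
    define err where "err = (\<lambda>n. 2 * (2 ^ n * exp (- 2 * real n)) + 2 powr (- (real n / 2)))"
    \<comment> \<open>For every \<open>n\<close>, including those where the eventual bounds on
      \<open>t\<close> fail: the cutoff needs only a nonnegative budget.\<close>
    have "is_strategy n (t n) (b n) (S n)" for n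
      using purchased_block_rule_le[of "b n"] C
      by (simp add: is_strategy_def S_def builder_graph_def b_def K\<^sub>2_def)
    moreover have "(\<lambda>n. success_prob n (t n) (S n) (has_factor \<alpha> F)) \<longlonglongrightarrow> 1"
    proof (rule tendsto_sandwich)
      have "(\<lambda>n. real n powr - \<delta>) \<longlonglongrightarrow> 0"
        using \<delta> by (intro tendsto_neg_powr filterlim_real_sequentially) auto
      \<comment> \<open>The upper bound on \<open>t\<close> enters here: it gives
        \<open>t \<le> n^2 / 4\<close>, hence at most the number of pairs when
        \<open>n \<ge> 2\<close>.\<close>
      then have "\<forall>\<^sub>F n in sequentially. real n powr - \<delta> < 1 / 4"
        by (rule order_tendstoD) simp
      with t eventually_ge_at_top[of 2]
      show "\<forall>\<^sub>F n in sequentially. 1 - err n \<le> success_prob n (t n) (S n) (has_factor \<alpha> F)"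
      proof eventually_elim
        case (elim n)
        define T where "T = real (t n)"
        have n: "2 \<le> n" "0 < real n" using elim by auto
        have lo: "K\<^sub>1 * real n powr (2 - 1 / d) \<le> T" using elim by (simp add: T_def)
        have T: "0 < T" using lo C n by (auto simp: K\<^sub>1_def intro: less_le_trans[rotated])
        have choose: "real (n choose 2) = real n * (real n - 1) / 2"
          by (rule real_choose_two)
        have "T \<le> (real n)\<^sup>2 * real n powr - \<delta>"
          using elim n by (simp add: T_def powr_diff powr_minus_divide powr_numeral)
        also have "\<dots> \<le> (real n)\<^sup>2 * (1 / 4)" using elim by (intro mult_left_mono) auto
        also have "\<dots> \<le> real (n choose 2)"
          using n mult_left_mono[of 2 "real n" "real n"] unfolding choose
          by (simp add: power2_eq_square field_simps)
        finally have "T \<le> real (n choose 2)" .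
        then have t_le: "t n \<le> n choose 2" by (simp add: T_def)
        have "real (n choose 2) \<le> (real n)\<^sup>2"
          using n unfolding choose by (simp add: power2_eq_square field_simps)
        with \<open>T \<le> real (n choose 2)\<close> have "T \<le> (real n)\<^sup>2" by linarith
        then have ratio: "1 \<le> (real n)\<^sup>2 / T" using T by simp
        have x: "x n = ((real n)\<^sup>2 / T) powr d" by (simp add: x_def T_def)
        have "((real n)\<^sup>2 / T) powr 1 \<le> x n"
          unfolding x using ratio d by (intro powr_mono) auto
        then have x_ge: "(real n)\<^sup>2 / T \<le> x n" using T by simp
        then have x1: "1 \<le> x n" using ratio by linarith
        have m_ge: "C * x n \<le> real (m n)" unfolding m_def by linarith
        have Cx: "0 < C * x n" using C x1 by simp
        then have m_le: "real (m n) \<le> C * x n + 1" unfolding m_def by linarith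
        have m_pos: "0 < m n" using m_ge Cx by (cases "m n") auto
        \<comment> \<open>The lower bound on \<open>t\<close> is what keeps blocks within
          \<open>n\<close>: it gives \<open>x n \<le> n / K\<^sub>1 powr d\<close>, and
          \<open>K\<^sub>1 powr d \<ge> K\<^sub>1\<close> since both \<open>K\<^sub>1\<close> and
          \<open>d\<close> are at least \<open>1\<close>.\<close>
        have "(real n)\<^sup>2 / T \<le> (real n)\<^sup>2 / (K\<^sub>1 * real n powr (2 - 1 / d))"
          using lo C n T by (intro divide_left_mono) (auto simp: K\<^sub>1_def)
        also have "\<dots> = real n powr (1 / d) / K\<^sub>1"
          using n by (simp add: powr_diff powr_numeral)
        finally have "x n \<le> (real n powr (1 / d) / K\<^sub>1) powr d"
          unfolding x using ratio d by (intro powr_mono2) auto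
        also have "\<dots> = real n / K\<^sub>1 powr d"
          using d C n by (simp add: powr_divide powr_powr K\<^sub>1_def)
        also have "\<dots> \<le> real n / K\<^sub>1 powr 1"
          using d C n by (intro divide_left_mono powr_mono) (auto simp: K\<^sub>1_def)
        also have "\<dots> = real n / (2 * C)" using C by (simp add: K\<^sub>1_def)
        finally have "C * x n \<le> real n / 2" using C by (simp add: field_simps)
        then have m_n: "m n \<le> n" using m_le n by linarith
        have "C = C * x n * (T / (real n)\<^sup>2) powr d"
          using T n unfolding x by (simp add: powr_mult[symmetric])
        also have "\<dots> \<le> real (m n) * (T / (real n)\<^sup>2) powr d"
          using m_ge by (intro mult_right_mono) auto
        finally have C_le: "C \<le> real (m n) * (T / (real n)\<^sup>2) powr d" .
        have b: "b n = K\<^sub>2 * (x n * T / real n)"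
        proof -
          have "x n = real n powr (2 * d) / T powr d"
            using n T by (simp add: x powr_divide powr_powr powr_numeral[symmetric] del: powr_numeral)
          then show ?thesis
            using n T by (simp add: b_def T_def powr_diff)
        qed
        have "16 * (T * real (m n) / real n) \<le> 16 * (T * ((C + 1) * x n) / real n)"
          using m_le x1 T n by (intro mult_left_mono divide_right_mono) (auto simp: algebra_simps)
        also have "\<dots> = b n" by (simp add: b K\<^sub>2_def mult_ac)
        finally have b1: "16 * (T * real (m n) / real n) \<le> b n" .
        \<comment> \<open>From \<open>d \<ge> 1\<close> follows \<open>x n \<ge> n^2 / T\<close>, so
          the budget is at least linear and the tail bound decays exponentially in
          \<open>n\<close>.\<close>
        have "real n = 1 * ((real n)\<^sup>2 / T * T / real n)"
          using n T by (simp add: power2_eq_square)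
        also have "\<dots> \<le> K\<^sub>2 * (x n * T / real n)"
          using x_ge T n C by (intro mult_mono divide_right_mono mult_right_mono) (auto simp: K\<^sub>2_def)
        finally have b2: "real n \<le> b n" by (simp add: b)
        show ?case
          unfolding err_def S_def
        proof (rule success_prob_block_rule[OF assms m_pos m_n _ t_le _ _ b2])
          show "0 < t n" using T by (simp add: T_def)
          show "2 ^ (card (verts F) + 10) * (real (card (verts F)))\<^sup>2 / (1 - \<alpha>) ^ 3
              \<le> real (m n) * (real (t n) / (real n)\<^sup>2) powr max_density F"
            using C_le by (simp add: C_def T_def d_def v_def)
          show "16 * (real (t n) * real (m n) / real n) \<le> b n"
            using b1 by (simp add: T_def)
        qed
      qed
      show "\<forall>\<^sub>F n in sequentially. success_prob n (t n) (S n) (has_factor \<alpha> F) \<le> 1"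
        by (simp add: success_prob_def)
      show "(\<lambda>n. 1 - err n) \<longlonglongrightarrow> 1"
      proof -
        have err: "err = (\<lambda>n. 2 * (2 * exp (- 2)) ^ n + (2 powr (- (1 / 2))) ^ n)"
          by (intro ext) (simp add: err_def power_mult_distrib exp_of_nat_mult[symmetric]
              mult.commute powr_realpow[symmetric] powr_powr)
        \<comment> \<open>The union bound wins because \<open>exp 2 \<ge> 3 > 2\<close>; both error
          terms are then geometric.\<close>
        have "2 * exp (- 2 :: real) < 1"
          using exp_ge_add_one_self[of "2 :: real"] by (simp add: exp_minus field_simps)
        then have lim1: "(\<lambda>n. (2 * exp (- 2 :: real)) ^ n) \<longlonglongrightarrow> 0"
          by (intro LIMSEQ_realpow_zero) auto
        have "(2 :: real) powr (- (1 / 2)) < 2 powr 0"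
          by (intro powr_less_mono) auto
        then have lim2: "(\<lambda>n. (2 powr (- (1 / 2)) :: real) ^ n) \<longlonglongrightarrow> 0"
          by (intro LIMSEQ_realpow_zero) auto
        have "(\<lambda>n. 1 - err n) \<longlonglongrightarrow> 1 - (2 * 0 + 0)"
          unfolding err by (intro tendsto_diff tendsto_add tendsto_mult tendsto_const lim1 lim2)
        then show ?thesis by simp
      qed
    qed simp
    ultimately show ?thesis unfolding successful_strategy_def b_def by blast
  qed
  then show "\<exists>K\<^sub>1 K\<^sub>2 :: real. K\<^sub>1 > 0 \<and> K\<^sub>2 > 0 \<and>
    (\<forall>t :: nat \<Rightarrow> nat.
      (\<forall>\<^sub>F n in sequentially.
         K\<^sub>1 * real n powr (2 - 1 / max_density F) \<le> real (t n) \<and>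
         real (t n) \<le> real n powr (2 - \<delta>)) \<longrightarrow>
      (\<exists>S :: nat \<Rightarrow> strategy.
         successful_strategy t
           (\<lambda>n. K\<^sub>2 * real (t n) powr (1 - max_density F) * real n powr (2 * max_density F - 1))
           S (has_factor \<alpha> F)))"
    using C by (intro exI[of _ K\<^sub>1] exI[of _ K\<^sub>2]) (auto simp: K\<^sub>1_def K\<^sub>2_def d_def)
qed

end
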